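(* Let $N\ge 2$ and let $\mathcal{S}$ be the stabilizer group of an $N$-qubit stabilizer state $|\mathcal{S}\rangle$. Let $\Omega\subset\{1,\dots,N\}$ be a nonempty proper subset of qubits with $|\Omega|=n<N$, and let $W_\Omega=\{s_1,\dots,s_n\}\subset\mathcal{S}$ be a set of $n$ stabilizers, written as $s_i=c_i\bigotimes_{\mu=1}^N s_{i\mu}$ with $c_i$ a phase and $s_{i\mu}\in\{I,X,Y,Z\}$. Then $W_\Omega$ satisfies both of the following conditions (A) there exist a local unitary $V_{LE}$ (a tensor product of single-qubit unitaries) and a non-singular $n\times n$ binary matrix $R_\Omega$ such that $V_{LE}\,W_\Omega^{(R_\Omega)}\,V_{LE}^{\dagger}=W_\Omega^{\mathcal{G}}$ for some simple undirected graph $\mathcal{G}$ on the vertex set $\{1,\dots,N\}$, where $W_\Omega^{(R_\Omega)}=\{\prod_{j=1}^n s_j^{[R_\Omega]_{ij}}: i=1,\dots,n\}$ (with $s_j^0=I$, $s_j^1=s_j$) and $W_\Omega^{\mathcal{G}}=\{g_\mu:\mu\in\Omega\}$ with $g_\mu=X_\mu\prod_{\nu\in\mathcal{N}_\mu}Z_\nu$, $\mathcal{N}_\mu$ being the set of neighbours of $\mu$ in $\mathcal{G}$; (B) the reduced graph state $|\mathcal{G}_\Omega\rangle$ associated with this $W_\Omega^{\mathcal{G}}$ is non-separable, i.e. the subgraph of $\mathcal{G}$ induced on $\Omega$ (vertices $\Omega$ and all edges of $\mathcal{G}$ with both endpoints in $\Omega$) is connected; if and only if $W_\Omega$ satisfies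 all of the following: (i) $W_\Omega$ consists of $n$ independent and mutually commuting stabilizers; (ii) the $n$ reduced Pauli operators $s_{\Omega,i}=\bigotimes_{\mu\in\Omega}s_{i\mu}$, $i=1,\dots,n$, are independent and mutually commute; (iii) the rows of the pseudo-incidence matrix $M(W_\Omega)$ corresponding to qubits outside $\Omega$ are zero, i.e. $M(W_\Omega)_{\eta l}=0$ for all columns $l$ and all $\eta\notin\Omega$; (iv) the rank of $M(W_\Omega)$ over $\mathbb{F}_2$ equals $n-1$.
   Context: Single-qubit Pauli operators are $I,X,Y,Z$. A stabilizer state $|\mathcal{S}\rangle$ on $N$ qubits is the unique common $+1$ eigenstate of an abelian group $\mathcal{S}$ of $2^N$ tensor products of single-qubit Pauli operators (with phase factors), not containing $-I$; its elements are called stabilizers. A set of Pauli operators is called independent if no nontrivial product of its elements is proportional to the identity. The pseudo-incidence matrix $M(W_\Omega)$ of $W_\Omega=\{s_1,\dots,s_n\}$ is the $N\times\binom{n}{2}$ binary matrix whose rows are indexed by qubits $\mu=1,\dots,N$ and whose columns are indexed by unordered pairs $l=\{i,j\}$, $i\neq j$, with $M(W_\Omega)_{\mu l}=1$ if the single-qubit Pauli operators $s_{i\mu}$ and $s_{j\mu}$ anticommute, and $M(W_\Omega)_{\mu l}=0$ if they commute. *)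

theory Defs
  imports Complex_Main "HOL-Library.Z2" "Jordan_Normal_Form.DL_Rank"
begin

section \<open>Single-qubit operators\<close>

text \<open>A single-qubit operator is a 2x2 complex matrix, indexed by the computational
  basis states False (= |0>) and True (= |1>).\<close>
type_synonym op1 = "bool \<Rightarrow> bool \<Rightarrow> complex"

definition mul1 :: "op1 \<Rightarrow> op1 \<Rightarrow> op1" where
  "mul1 A B = (\<lambda>x y. A x False * B False y + A x True * B True y)"

definition adj1 :: "op1 \<Rightarrow> op1" where
  "adj1 A = (\<lambda>x y. cnj (A y x))"

definition id1 :: op1 where
  "id1 = (\<lambda>x y. if x = y then 1 else 0)"

definition unitary1 :: "op1 \<Rightarrow> bool" where
  "unitary1 U \<longleftrightarrow> mul1 U (adj1 U) = id1 \<and> mul1 (adj1 U) U = id1"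

datatype pauli = PI | PX | PY | PZ

text \<open>Matrices of I, X, Y, Z in the computational basis.\<close>
fun pmat :: "pauli \<Rightarrow> op1" where
  "pmat PI = id1"
| "pmat PX = (\<lambda>x y. if x \<noteq> y then 1 else 0)"
| "pmat PY = (\<lambda>x y. if x = y then 0 else if x then \<i> else - \<i>)"
| "pmat PZ = (\<lambda>x y. if x = y then (if x then -1 else 1) else 0)"

definition anticomm1 :: "pauli \<Rightarrow> pauli \<Rightarrow> bool" where
  "anticomm1 a b \<longleftrightarrow> mul1 (pmat a) (pmat b) = (\<lambda>x y. - mul1 (pmat b) (pmat a) x y)"

section \<open>Multi-qubit operators on a finite set Q of qubits\<close>

text \<open>Basis states of the qubits in Q: bit assignments vanishing outside Q.
  An operator on the qubits Q is its matrix indexed by basis states; entries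
  with an index outside the basis are 0.\<close>
type_synonym qop = "(nat \<Rightarrow> bool) \<Rightarrow> (nat \<Rightarrow> bool) \<Rightarrow> complex"

definition qbasis :: "nat set \<Rightarrow> (nat \<Rightarrow> bool) set" where
  "qbasis Q = {x. \<forall>\<mu>. \<mu> \<notin> Q \<longrightarrow> \<not> x \<mu>}"

definition opmul :: "nat set \<Rightarrow> qop \<Rightarrow> qop \<Rightarrow> qop" where
  "opmul Q A B = (\<lambda>x y. \<Sum>z\<in>qbasis Q. A x z * B z y)"

definition opadj :: "qop \<Rightarrow> qop" where
  "opadj A = (\<lambda>x y. cnj (A y x))"

definition opscale :: "complex \<Rightarrow> qop \<Rightarrow> qop" where
  "opscale c A = (\<lambda>x y. c * A x y)"

text \<open>Tensor product of single-qubit operators A mu, mu in Q.\<close>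
definition tens :: "nat set \<Rightarrow> (nat \<Rightarrow> op1) \<Rightarrow> qop" where
  "tens Q A = (\<lambda>x y. if x \<in> qbasis Q \<and> y \<in> qbasis Q then (\<Prod>\<mu>\<in>Q. A \<mu> (x \<mu>) (y \<mu>)) else 0)"

definition opid :: "nat set \<Rightarrow> qop" where
  "opid Q = tens Q (\<lambda>_. id1)"

text \<open>Pauli operator c * (tensor over mu in Q of the Pauli p mu).\<close>
definition psem :: "nat set \<Rightarrow> complex \<Rightarrow> (nat \<Rightarrow> pauli) \<Rightarrow> qop" where
  "psem Q c p = opscale c (tens Q (\<lambda>\<mu>. pmat (p \<mu>)))"

definition commute_op :: "nat set \<Rightarrow> qop \<Rightarrow> qop \<Rightarrow> bool" where
  "commute_op Q A B \<longleftrightarrow> opmul Q A B = opmul Q B A"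

text \<open>Ordered product O_{j1} O_{j2} ... over the indices j in T (j < n), increasing order.\<close>
definition opprod :: "nat set \<Rightarrow> nat \<Rightarrow> (nat \<Rightarrow> qop) \<Rightarrow> nat set \<Rightarrow> qop" where
  "opprod Q n Ops T = foldr (\<lambda>j acc. if j \<in> T then opmul Q (Ops j) acc else acc) [0..<n] (opid Q)"

text \<open>Independence of O_0, ..., O_{n-1}: no nontrivial product is proportional to the identity.\<close>
definition independent_ops :: "nat set \<Rightarrow> nat \<Rightarrow> (nat \<Rightarrow> qop) \<Rightarrow> bool" where
  "independent_ops Q n Ops \<longleftrightarrow>
     (\<forall>T. T \<subseteq> {..<n} \<and> T \<noteq> {} \<longrightarrow> \<not> (\<exists>a. opprod Q n Ops T = opscale a (opid Q)))"

definition mutually_commuting :: "nat set \<Rightarrow> nat \<Rightarrow> (nat \<Rightarrow> qop) \<Rightarrow> bool" where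
  "mutually_commuting Q n Ops \<longleftrightarrow> (\<forall>i<n. \<forall>j<n. commute_op Q (Ops i) (Ops j))"

section \<open>Stabilizer groups on N qubits (qubits 0, ..., N-1)\<close>

definition is_pauli_op :: "nat \<Rightarrow> qop \<Rightarrow> bool" where
  "is_pauli_op N A \<longleftrightarrow> (\<exists>c p. c \<in> {1, -1, \<i>, -\<i>} \<and> A = psem {..<N} c p)"

definition stabilizer_group :: "nat \<Rightarrow> qop set \<Rightarrow> bool" where
  "stabilizer_group N S \<longleftrightarrow>
     (\<forall>A\<in>S. is_pauli_op N A)
   \<and> opid {..<N} \<in> S
   \<and> (\<forall>A\<in>S. \<forall>B\<in>S. opmul {..<N} A B \<in> S)
   \<and> (\<forall>A\<in>S. \<exists>B\<in>S. opmul {..<N} A B = opid {..<N})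
   \<and> (\<forall>A\<in>S. \<forall>B\<in>S. commute_op {..<N} A B)
   \<and> finite S \<and> card S = 2 ^ N
   \<and> opscale (-1) (opid {..<N}) \<notin> S"

text \<open>Local unitary V = tensor of U mu (mu < N), acting by conjugation.\<close>
definition local_unitary :: "nat \<Rightarrow> (nat \<Rightarrow> op1) \<Rightarrow> bool" where
  "local_unitary N U \<longleftrightarrow> (\<forall>\<mu><N. unitary1 (U \<mu>))"

definition conj_by :: "nat \<Rightarrow> (nat \<Rightarrow> op1) \<Rightarrow> qop \<Rightarrow> qop" where
  "conj_by N U A = opmul {..<N} (opmul {..<N} (tens {..<N} U) A) (opadj (tens {..<N} U))"

section \<open>Graphs and graph-state generators\<close>

definition simple_graph :: "nat \<Rightarrow> (nat \<Rightarrow> nat \<Rightarrow> bool) \<Rightarrow> bool" where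
  "simple_graph N E \<longleftrightarrow> (\<forall>u v. E u v \<longrightarrow> u < N \<and> v < N \<and> u \<noteq> v \<and> E v u)"

text \<open>g_mu = X_mu times the product of Z_nu over the neighbours nu of mu.\<close>
definition graph_gen :: "nat \<Rightarrow> (nat \<Rightarrow> nat \<Rightarrow> bool) \<Rightarrow> nat \<Rightarrow> qop" where
  "graph_gen N E \<mu> = psem {..<N} 1 (\<lambda>\<nu>. if \<nu> = \<mu> then PX else if E \<mu> \<nu> then PZ else PI)"

definition induced_connected :: "(nat \<Rightarrow> nat \<Rightarrow> bool) \<Rightarrow> nat set \<Rightarrow> bool" where
  "induced_connected E \<Omega> \<longleftrightarrow>
     (\<forall>u\<in>\<Omega>. \<forall>v\<in>\<Omega>. (u, v) \<in> {(a, b). a \<in> \<Omega> \<and> b \<in> \<Omega> \<and> E a b}\<^sup>*)"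

section \<open>Pseudo-incidence matrix over F_2\<close>

definition pairs_list :: "nat \<Rightarrow> (nat \<times> nat) list" where
  "pairs_list n = concat (map (\<lambda>i. map (\<lambda>j. (i, j)) [Suc i..<n]) [0..<n])"

text \<open>Rows: qubits mu < N; columns: unordered pairs {i,j}, i < j < n (enumerated by pairs_list).\<close>
definition pseudo_incidence :: "nat \<Rightarrow> nat \<Rightarrow> (nat \<Rightarrow> nat \<Rightarrow> pauli) \<Rightarrow> bit mat" where
  "pseudo_incidence N n sp = mat N (length (pairs_list n))
     (\<lambda>(\<mu>, l). if anticomm1 (sp (fst (pairs_list n ! l)) \<mu>) (sp (snd (pairs_list n ! l)) \<mu>) then 1 else 0)"

definition rank_F2 :: "nat \<Rightarrow> bit mat \<Rightarrow> nat" where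
  "rank_F2 nr M = vec_space.rank nr M"

end

theory Submission
  imports Defs
begin

text \<open>
  Up to phases, the Pauli operators on a set of qubits form a vector space over the two-element field,
  and two of them commute iff a sum of single-qubit symplectic forms vanishes. Each condition of the
  theorem concerns only this space and these forms, which local unitaries preserve and which transform bilinearly
  under the binary matrix \<open>R\<close>.

  For the construction of the graph, one chooses on each qubit of \<open>\<Omega>\<close> a Pauli line
  such that no nontrivial product of the reduced stabilizers lies in all these lines. Then the
  matrix recording which stabilizer leaves which line is invertible. Its inverse \<open>R\<close> yields
  products that leave their line on exactly one qubit each, and single-qubit Clifford unitaries
  turn the lines into \<open>Z\<close> and the remaining factors into \<open>X\<close>. Commutation on \<open>\<Omega>\<close> makes the resulting
  adjacency symmetric, and signs are absorbed because elements of the stabilizer group carry phase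
  \<open>1\<close> or \<open>-1\<close>.

  In graph form, the column space of the pseudo-incidence matrix is spanned by the vectors
  \<open>e\<^sub>a + e\<^sub>b\<close> for the edges \<open>ab\<close> inside \<open>\<Omega>\<close>. It lies in the
  \<open>(n - 1)\<close>-dimensional space of vectors supported on \<open>\<Omega>\<close> with coordinate sum zero,
  and fills it iff the induced graph is connected.
\<close>

section \<open>Single-qubit Pauli operators as a symplectic space\<close>

text \<open>Pauli multiplication modulo phase is the Klein four-group, hence a vector space over the
  two-element field in which every element is its own negative.\<close>

instantiation pauli :: ab_group_add
begin
definition zero_pauli :: pauli where "0 = PI"
fun plus_pauli :: "pauli \<Rightarrow> pauli \<Rightarrow> pauli" where
  "PI + b = b"
| "a + PI = a"
| "PX + PX = PI" | "PX + PY = PZ" | "PX + PZ = PY"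
| "PY + PX = PZ" | "PY + PY = PI" | "PY + PZ = PX"
| "PZ + PX = PY" | "PZ + PY = PX" | "PZ + PZ = PI"
definition uminus_pauli :: "pauli \<Rightarrow> pauli" where "uminus_pauli a = a"
definition minus_pauli :: "pauli \<Rightarrow> pauli \<Rightarrow> pauli" where "minus_pauli a b = a + b"
instance
proof
  fix a b c :: pauli
  show "a + b + c = a + (b + c)" by (cases a; cases b; cases c) simp_all
  show "a + b = b + a" by (cases a; cases b) simp_all
  show "0 + a = a" by (simp add: zero_pauli_def)
  show "- a + a = 0" by (cases a) (simp_all add: zero_pauli_def uminus_pauli_def)
  show "a - b = a + - b" by (simp add: minus_pauli_def uminus_pauli_def)
qed
end

lemma pauli_add_self [simp]: "(a::pauli) + a = 0"
  by (cases a) (simp_all add: zero_pauli_def)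

text \<open>The symplectic form on the two-dimensional binary space. Its values are bits, so that
  summing over qubits gives the parity of the number of anticommuting positions.\<close>

definition sympl :: "pauli \<Rightarrow> pauli \<Rightarrow> bit" where
  "sympl a b = (if a = 0 \<or> b = 0 \<or> a = b then 0 else 1)"

lemma sympl_add_left: "sympl (a + b) c = sympl a c + sympl b c"
  by (cases a; cases b; cases c) (simp_all add: sympl_def zero_pauli_def)

lemma sympl_commute: "sympl a b = sympl b a"
  by (auto simp: sympl_def)

lemma sympl_zero [simp]: "sympl 0 a = 0" "sympl a 0 = 0" "sympl a a = 0"
  by (simp_all add: sympl_def)

lemma sympl_sum_left: "sympl (sum f T) c = (\<Sum>j\<in>T. sympl (f j) c)"
  by (induction T rule: infinite_finite_induct) (simp_all add: sympl_add_left)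

lemma sympl_sum_right: "sympl c (sum f T) = (\<Sum>j\<in>T. sympl c (f j))"
  by (simp add: sympl_commute[of c] sympl_sum_left)

lemma sympl_eq_0_iff: "sympl a b = 0 \<longleftrightarrow> a = 0 \<or> b = 0 \<or> a = b"
  by (simp add: sympl_def)

text \<open>The scalar that the group structure on \<open>pauli\<close> forgets: \<open>\<i>\<close>
  for a product in cyclic order, such as XY = \<open>\<i>\<close>Z, and its conjugate in the reverse
  order.\<close>

definition phase :: "pauli \<Rightarrow> pauli \<Rightarrow> complex" where
  "phase a b = (if a = PI \<or> b = PI \<or> a = b then 1
     else if (a, b) \<in> {(PX, PY), (PY, PZ), (PZ, PX)} then \<i> else - \<i>)"

lemma phase_nonzero [simp]: "phase a b \<noteq> 0"
  by (simp add: phase_def)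

lemma mul1_pmat: "mul1 (pmat a) (pmat b) = (\<lambda>x y. phase a b * pmat (a + b) x y)"
  by (cases a; cases b) (auto simp: mul1_def phase_def id1_def fun_eq_iff zero_pauli_def)

lemma phase_commute: "phase b a = (if sympl a b = 1 then -1 else 1) * phase a b"
  by (cases a; cases b) (simp_all add: phase_def sympl_def zero_pauli_def)

lemma pmat_nonzero: "\<exists>x y. pmat a x y \<noteq> 0"
proof -
  have "pmat a False False \<noteq> 0 \<or> pmat a False True \<noteq> 0"
    by (cases a) (simp_all add: id1_def)
  then show ?thesis by blast
qed

lemma anticomm1_iff: "anticomm1 a b \<longleftrightarrow> sympl a b = 1"
proof -
  \<comment> \<open>A nonzero entry of the product excludes that two matrices commute and
    anticommute at once.\<close>
  obtain x y where xy: "pmat (a + b) x y \<noteq> 0" using pmat_nonzero by blast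
  show ?thesis
  proof (cases "sympl a b = 1")
    case True
    then show ?thesis
      by (simp add: anticomm1_def mul1_pmat phase_commute[of b a] fun_eq_iff add.commute)
  next
    case False
    then have "\<not> anticomm1 a b"
      using xy by (auto simp: anticomm1_def mul1_pmat phase_commute[of b a] fun_eq_iff add.commute)
    then show ?thesis using False by simp
  qed
qed

lemma pmat_prop_inj:
  assumes "pmat a = (\<lambda>x y. k * pmat b x y)" shows "a = b"
proof -
  have e: "pmat a x y = k * pmat b x y" for x y by (subst assms) simp
  show ?thesis
    using e[of False False] e[of False True] e[of True False] e[of True True]
    by (cases a; cases b) (simp_all add: id1_def complex_eq_iff)
qed

lemma mul1_assoc: "mul1 (mul1 A B) C = mul1 A (mul1 B C)"
  by (simp add: mul1_def fun_eq_iff algebra_simps)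

lemma mul1_id [simp]: "mul1 id1 A = A" "mul1 A id1 = A"
  by (auto simp: mul1_def id1_def fun_eq_iff)

section \<open>Tensor products\<close>

text \<open>Expanding the product of two-term sums gives one summand per choice function on
  \<open>Q\<close>. Such functions are undefined outside \<open>Q\<close>, while basis states are
  False there, which explains the two translation maps.\<close>

lemma prod_sum_qbasis:
  fixes F :: "nat \<Rightarrow> bool \<Rightarrow> complex"
  assumes "finite Q"
  shows "(\<Sum>z\<in>qbasis Q. \<Prod>\<mu>\<in>Q. F \<mu> (z \<mu>)) = (\<Prod>\<mu>\<in>Q. F \<mu> False + F \<mu> True)"
proof -
  have "(\<Prod>\<mu>\<in>Q. F \<mu> False + F \<mu> True) = (\<Prod>\<mu>\<in>Q. \<Sum>b\<in>UNIV. F \<mu> b)"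
    by (simp add: UNIV_bool)
  also have "\<dots> = (\<Sum>g\<in>PiE Q (\<lambda>_. UNIV). \<Prod>\<mu>\<in>Q. F \<mu> (g \<mu>))"
    using assms by (simp add: prod_sum_PiE)
  also have "\<dots> = (\<Sum>z\<in>qbasis Q. \<Prod>\<mu>\<in>Q. F \<mu> (z \<mu>))"
    by (rule sum.reindex_bij_witness[where i = "\<lambda>z. restrict z Q" and j = "\<lambda>g \<mu>. \<mu> \<in> Q \<and> g \<mu>"])
       (auto simp: qbasis_def restrict_def fun_eq_iff PiE_iff extensional_def)
  finally show ?thesis by simp
qed

lemma opmul_tens:
  assumes "finite Q"
  shows "opmul Q (tens Q A) (tens Q B) = tens Q (\<lambda>\<mu>. mul1 (A \<mu>) (B \<mu>))"
proof (intro ext)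
  fix x y
  show "opmul Q (tens Q A) (tens Q B) x y = tens Q (\<lambda>\<mu>. mul1 (A \<mu>) (B \<mu>)) x y"
  proof (cases "x \<in> qbasis Q \<and> y \<in> qbasis Q")
    case True
    then have "opmul Q (tens Q A) (tens Q B) x y
        = (\<Sum>z\<in>qbasis Q. \<Prod>\<mu>\<in>Q. A \<mu> (x \<mu>) (z \<mu>) * B \<mu> (z \<mu>) (y \<mu>))"
      by (simp add: opmul_def tens_def prod.distrib)
    also have "\<dots> = (\<Prod>\<mu>\<in>Q. mul1 (A \<mu>) (B \<mu>) (x \<mu>) (y \<mu>))"
      by (subst prod_sum_qbasis[OF assms]) (simp add: mul1_def)
    finally show ?thesis using True by (simp add: tens_def)
  qed (auto simp: opmul_def tens_def)
qed

lemma opadj_tens: "opadj (tens Q A) = tens Q (\<lambda>\<mu>. adj1 (A \<mu>))"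
  by (auto simp: opadj_def tens_def adj1_def fun_eq_iff)

lemma opmul_scale: "opmul Q (opscale a A) (opscale b B) = opscale (a * b) (opmul Q A B)"
  by (simp add: opmul_def opscale_def fun_eq_iff sum_distrib_left mult_ac)

lemma opscale_opscale [simp]: "opscale a (opscale b A) = opscale (a * b) A"
  by (simp add: opscale_def fun_eq_iff mult_ac)

lemma opscale_1 [simp]: "opscale 1 A = A"
  by (simp add: opscale_def)

lemma tens_scale:
  "tens Q (\<lambda>\<mu> x y. k \<mu> * A \<mu> x y) = opscale (\<Prod>\<mu>\<in>Q. k \<mu>) (tens Q A)"
  by (auto simp: tens_def opscale_def fun_eq_iff prod.distrib)

lemma tens_cong: "(\<And>\<mu>. \<mu> \<in> Q \<Longrightarrow> A \<mu> = B \<mu>) \<Longrightarrow> tens Q A = tens Q B"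
  by (auto simp: tens_def fun_eq_iff)

text \<open>Only the ray of each tensor factor is determined by a product operator, hence the
  proportionality constant.\<close>
lemma tens_factor:
  assumes "finite Q" "\<And>\<mu>. \<mu> \<in> Q \<Longrightarrow> \<exists>x y. A \<mu> x y \<noteq> 0" "\<And>\<mu>. \<mu> \<in> Q \<Longrightarrow> \<exists>x y. B \<mu> x y \<noteq> 0"
    "opscale a (tens Q A) = opscale b (tens Q B)" "a \<noteq> 0 \<or> b \<noteq> 0" "\<nu> \<in> Q"
  shows "\<exists>k. k \<noteq> 0 \<and> A \<nu> = (\<lambda>x y. k * B \<nu> x y)"
proof -
  \<comment> \<open>The situation is symmetric in the two sides, so the argument is made for a
    nonzero left coefficient and then used in both directions. All qubits but \<nu> are frozen at a
    nonzero entry of \<open>A\<close>, and only the indices at \<nu> vary.\<close>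
  have one: "b \<noteq> 0 \<and> (\<exists>k. A \<nu> = (\<lambda>x y. k * B \<nu> x y))"
    if eq: "opscale a (tens Q A) = opscale b (tens Q B)" and a: "a \<noteq> 0"
      and nz: "\<And>\<mu>. \<mu> \<in> Q \<Longrightarrow> \<exists>x y. A \<mu> x y \<noteq> 0" for a b :: complex and A B :: "nat \<Rightarrow> op1"
  proof -
    obtain x y where xy: "\<And>\<mu>. \<mu> \<in> Q \<Longrightarrow> A \<mu> (x \<mu>) (y \<mu>) \<noteq> 0" using nz by metis
    define X where "X u = (\<lambda>\<mu>. \<mu> \<in> Q \<and> (if \<mu> = \<nu> then u else x \<mu>))" for u
    define Y where "Y v = (\<lambda>\<mu>. \<mu> \<in> Q \<and> (if \<mu> = \<nu> then v else y \<mu>))" for v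
    have XY: "X u \<in> qbasis Q" "Y u \<in> qbasis Q" for u by (auto simp: X_def Y_def qbasis_def)
    have T: "tens Q C (X u) (Y v) = C \<nu> u v * (\<Prod>\<mu>\<in>Q - {\<nu>}. C \<mu> (x \<mu>) (y \<mu>))" for C u v
    proof -
      have "tens Q C (X u) (Y v) = (\<Prod>\<mu>\<in>Q. C \<mu> (X u \<mu>) (Y v \<mu>))"
        using XY by (simp add: tens_def)
      also have "\<dots> = C \<nu> (X u \<nu>) (Y v \<nu>) * (\<Prod>\<mu>\<in>Q - {\<nu>}. C \<mu> (X u \<mu>) (Y v \<mu>))"
        using assms(1,6) by (rule prod.remove)
      also have "(\<Prod>\<mu>\<in>Q - {\<nu>}. C \<mu> (X u \<mu>) (Y v \<mu>)) = (\<Prod>\<mu>\<in>Q - {\<nu>}. C \<mu> (x \<mu>) (y \<mu>))"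
        by (rule prod.cong) (auto simp: X_def Y_def)
      finally show ?thesis using assms(6) by (simp add: X_def Y_def)
    qed
    let ?p = "a * (\<Prod>\<mu>\<in>Q - {\<nu>}. A \<mu> (x \<mu>) (y \<mu>))" and ?q = "b * (\<Prod>\<mu>\<in>Q - {\<nu>}. B \<mu> (x \<mu>) (y \<mu>))"
    have p: "?p \<noteq> 0" using xy a assms(1) by simp
    have e: "?p * A \<nu> u v = ?q * B \<nu> u v" for u v
      using fun_cong[OF fun_cong[OF eq], of "X u" "Y v"] by (simp add: opscale_def T mult_ac)
    have solve: "r * w = t * z \<Longrightarrow> r \<noteq> 0 \<Longrightarrow> w = (t / r) * z" for r t w z :: complex
      by (simp add: field_simps)
    have "A \<nu> = (\<lambda>x y. (?q / ?p) * B \<nu> x y)"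
    proof (intro ext)
      fix u v
      show "A \<nu> u v = (?q / ?p) * B \<nu> u v" using e[of u v] p by (rule solve)
    qed
    moreover have "b \<noteq> 0" using e[of "x \<nu>" "y \<nu>"] p xy[OF assms(6)] by auto
    ultimately show ?thesis by blast
  qed
  have a: "a \<noteq> 0" using assms(5) one[OF assms(4)[symmetric] _ assms(3)] by blast
  obtain k where k: "A \<nu> = (\<lambda>x y. k * B \<nu> x y)" using one[OF assms(4) a assms(2)] by blast
  have "k \<noteq> 0" using assms(2)[OF assms(6)] k by auto
  then show ?thesis using k by blast
qed

section \<open>Pauli operators as a scalar together with a vector of single-qubit Paulis\<close>

lemma psem_mult:
  assumes "finite Q"
  shows "opmul Q (psem Q c p) (psem Q d q)
    = psem Q (c * d * (\<Prod>\<mu>\<in>Q. phase (p \<mu>) (q \<mu>))) (\<lambda>\<mu>. p \<mu> + q \<mu>)"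
  by (simp add: psem_def opmul_scale opmul_tens[OF assms] mul1_pmat tens_scale)

lemma psem_cong: "(\<And>\<mu>. \<mu> \<in> Q \<Longrightarrow> p \<mu> = q \<mu>) \<Longrightarrow> psem Q c p = psem Q c q"
  by (auto simp: psem_def intro!: arg_cong[where f = "opscale c"] tens_cong)

lemma psem_eqD:
  assumes "finite Q" "psem Q c p = psem Q d q" "c \<noteq> 0 \<or> d \<noteq> 0" "\<mu> \<in> Q"
  shows "p \<mu> = q \<mu>"
proof -
  have "\<exists>k. k \<noteq> 0 \<and> pmat (p \<mu>) = (\<lambda>x y. k * pmat (q \<mu>) x y)"
    by (rule tens_factor[OF assms(1) _ _ assms(2)[unfolded psem_def] assms(3,4)]) (rule pmat_nonzero)+
  then show ?thesis using pmat_prop_inj by metis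
qed

lemma tens_pmat_nonzero:
  assumes "finite Q"
  shows "\<exists>x y. tens Q (\<lambda>\<mu>. pmat (p \<mu>)) x y \<noteq> 0"
proof -
  have "\<forall>\<mu>. \<exists>x y. pmat (p \<mu>) x y \<noteq> 0" using pmat_nonzero by blast
  then obtain x y where xy: "\<And>\<mu>. pmat (p \<mu>) (x \<mu>) (y \<mu>) \<noteq> 0" by metis
  have "tens Q (\<lambda>\<mu>. pmat (p \<mu>)) (\<lambda>\<mu>. \<mu> \<in> Q \<and> x \<mu>) (\<lambda>\<mu>. \<mu> \<in> Q \<and> y \<mu>) \<noteq> 0"
    using assms xy by (simp add: tens_def qbasis_def)
  then show ?thesis by blast
qed

lemma psem_eq_scalar:
  assumes "finite Q" "psem Q c p = psem Q d p"
  shows "c = d"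
proof -
  obtain x y where "tens Q (\<lambda>\<mu>. pmat (p \<mu>)) x y \<noteq> 0" using tens_pmat_nonzero[OF assms(1)] by blast
  then show ?thesis using fun_cong[OF fun_cong[OF assms(2)], of x y] by (simp add: psem_def opscale_def)
qed

lemma opid_psem: "opid Q = psem Q 1 (\<lambda>_. 0)"
  by (simp add: opid_def psem_def zero_pauli_def)

lemma opscale_psem: "opscale a (psem Q c p) = psem Q (a * c) p"
  by (simp add: psem_def)

lemma psem_scalar_iff:
  assumes "finite Q" "c \<noteq> 0"
  shows "(\<exists>a. psem Q c p = opscale a (opid Q)) \<longleftrightarrow> (\<forall>\<mu>\<in>Q. p \<mu> = 0)"
proof
  assume "\<exists>a. psem Q c p = opscale a (opid Q)"
  then show "\<forall>\<mu>\<in>Q. p \<mu> = 0"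
    using psem_eqD[OF assms(1)] assms(2) unfolding opid_psem opscale_psem by blast
next
  assume "\<forall>\<mu>\<in>Q. p \<mu> = 0"
  then have "psem Q c p = opscale c (opid Q)"
    unfolding opid_psem opscale_psem by (auto intro: psem_cong)
  then show "\<exists>a. psem Q c p = opscale a (opid Q)" ..
qed

lemma prod_sign:
  assumes "finite Q"
  shows "(\<Prod>\<mu>\<in>Q. if f \<mu> = 1 then -1 else 1 :: complex) = (if (\<Sum>\<mu>\<in>Q. f \<mu> :: bit) = 1 then -1 else 1)"
  using assms
proof (induction Q)
  case (insert a Q)
  then show ?case by (cases "f a"; cases "sum f Q") simp_all
qed simp

text \<open>Reversing the order of the factors costs one sign per anticommuting qubit, so only the
  parity of their number matters. The scalars must be nonzero for this sign to be visible.\<close>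

lemma commute_psem_iff:
  assumes "finite Q" "c \<noteq> 0" "d \<noteq> 0"
  shows "commute_op Q (psem Q c p) (psem Q d q) \<longleftrightarrow> (\<Sum>\<mu>\<in>Q. sympl (p \<mu>) (q \<mu>)) = 0"
proof -
  let ?w = "\<Prod>\<mu>\<in>Q. phase (p \<mu>) (q \<mu>)" and ?s = "\<Sum>\<mu>\<in>Q. sympl (p \<mu>) (q \<mu>)"
  have w: "?w \<noteq> 0" using assms(1) by simp
  have "(\<Prod>\<mu>\<in>Q. phase (q \<mu>) (p \<mu>)) = (if ?s = 1 then -1 else 1) * ?w"
    by (subst phase_commute) (simp only: prod.distrib prod_sign[OF assms(1)])
  then have "commute_op Q (psem Q c p) (psem Q d q) \<longleftrightarrow>
     psem Q (c * d * ?w) (\<lambda>\<mu>. p \<mu> + q \<mu>) = psem Q (c * d * ((if ?s = 1 then -1 else 1) * ?w)) (\<lambda>\<mu>. p \<mu> + q \<mu>)"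
    by (simp add: commute_op_def psem_mult[OF assms(1)] add.commute mult.commute[of d])
  also have "\<dots> \<longleftrightarrow> c * d * ?w = c * d * ((if ?s = 1 then -1 else 1) * ?w)"
    by (rule iffI, erule psem_eq_scalar[OF assms(1)], erule arg_cong)
  also have "\<dots> \<longleftrightarrow> ?s = 0"
    using w assms by auto
  finally show ?thesis .
qed

text \<open>The phase of the product stays existential: independence only needs it to be nonzero,
  and where its sign matters, membership in the stabilizer group determines it up to
  \<open>1\<close> or \<open>-1\<close>.\<close>

lemma opprod_psem:
  assumes "finite Q" "\<And>j. j < n \<Longrightarrow> c j \<noteq> 0"
  shows "\<exists>d. d \<noteq> 0 \<and> opprod Q n (\<lambda>j. psem Q (c j) (p j)) T
     = psem Q d (\<lambda>\<mu>. \<Sum>j\<in>T \<inter> {..<n}. p j \<mu>)"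
proof -
  have "\<exists>d. d \<noteq> 0 \<and> foldr (\<lambda>j acc. if j \<in> T then opmul Q (psem Q (c j) (p j)) acc else acc) xs (opid Q)
     = psem Q d (\<lambda>\<mu>. \<Sum>j\<in>T \<inter> set xs. p j \<mu>)"
    if "distinct xs" "set xs \<subseteq> {..<n}" for xs
    using that
  proof (induction xs)
    case Nil
    then show ?case by (auto simp: opid_psem intro!: exI[of _ 1])
  next
    case (Cons a xs)
    then obtain d where d: "d \<noteq> 0" "foldr (\<lambda>j acc. if j \<in> T then opmul Q (psem Q (c j) (p j)) acc else acc) xs (opid Q)
     = psem Q d (\<lambda>\<mu>. \<Sum>j\<in>T \<inter> set xs. p j \<mu>)" by auto
    show ?case
    proof (cases "a \<in> T")
      case True
      then have "T \<inter> set (a # xs) = insert a (T \<inter> set xs)" by auto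
      moreover have "a \<notin> T \<inter> set xs" using Cons by auto
      ultimately show ?thesis using True d Cons.prems assms
        by (intro exI[of _ "c a * d * (\<Prod>\<mu>\<in>Q. phase (p a \<mu>) (\<Sum>j\<in>T \<inter> set xs. p j \<mu>))"])
           (auto simp: psem_mult[OF assms(1)])
    next
      case False
      then have "T \<inter> set (a # xs) = T \<inter> set xs" by auto
      then show ?thesis using False d by auto
    qed
  qed
  from this[of "[0..<n]"] show ?thesis
    by (simp add: opprod_def atLeast0LessThan)
qed

lemma independent_psem_iff:
  assumes "finite Q" "\<And>j. j < n \<Longrightarrow> c j \<noteq> 0"
  shows "independent_ops Q n (\<lambda>j. psem Q (c j) (p j)) \<longleftrightarrow>
    (\<forall>T. T \<subseteq> {..<n} \<and> T \<noteq> {} \<longrightarrow> (\<exists>\<mu>\<in>Q. (\<Sum>j\<in>T. p j \<mu>) \<noteq> 0))"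
proof -
  have "(\<exists>a. opprod Q n (\<lambda>j. psem Q (c j) (p j)) T = opscale a (opid Q)) \<longleftrightarrow> (\<forall>\<mu>\<in>Q. (\<Sum>j\<in>T. p j \<mu>) = 0)"
    if "T \<subseteq> {..<n}" for T
  proof -
    have "T \<inter> {..<n} = T" using that by auto
    moreover obtain d where "d \<noteq> 0" "opprod Q n (\<lambda>j. psem Q (c j) (p j)) T
        = psem Q d (\<lambda>\<mu>. \<Sum>j\<in>T \<inter> {..<n}. p j \<mu>)"
      using opprod_psem[of Q n c p T] assms by blast
    ultimately show ?thesis
      using psem_scalar_iff[OF assms(1)] by simp
  qed
  then show ?thesis unfolding independent_ops_def by auto
qed

lemma conj_by_psem:
  "conj_by N U (psem {..<N} c p) =
     opscale c (tens {..<N} (\<lambda>\<mu>. mul1 (mul1 (U \<mu>) (pmat (p \<mu>))) (adj1 (U \<mu>))))"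
proof -
  have "opmul Q A (opscale c B) = opscale c (opmul Q A B)" "opmul Q (opscale c A) B = opscale c (opmul Q A B)" for Q A B
    by (simp_all add: opmul_def opscale_def fun_eq_iff sum_distrib_left mult_ac)
  then show ?thesis by (simp add: conj_by_def psem_def opadj_tens opmul_tens)
qed

section \<open>Local Clifford operations\<close>

text \<open>The rows of the unitary are the conjugates of the \<open>+1\<close> eigenvector \<open>e\<close> of \<^term>\<open>l\<close> and of \<open>s q e\<close>.\<close>
lemma clifford_exists:
  assumes "q \<noteq> 0" "l \<noteq> 0" "q \<noteq> l" "s \<in> {1, -1 :: complex}"
  shows "\<exists>U. unitary1 U \<and> mul1 (mul1 U (pmat q)) (adj1 U) = (\<lambda>x y. s * pmat PX x y)
     \<and> mul1 (mul1 U (pmat l)) (adj1 U) = pmat PZ"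
proof -
  define h where "h = complex_of_real (1 / sqrt 2)"
  have h: "cnj h = h" "h * h = 1 / 2" "\<And>x. h * (h * x) = 1 / 2 * x"
    by (simp_all add: h_def flip: of_real_mult mult.assoc)
  have i: "\<And>x. \<i> * (\<i> * x) = - x"
    by (simp flip: mult.assoc)
  define e where "e = (\<lambda>x. if l = PZ then (if x then 0 else 1) else if l = PX then h else if x then \<i> * h else h)"
  \<comment> \<open>As \<open>q\<close> anticommutes with \<open>l\<close>, the vector
    \<open>f\<close> is a \<open>-1\<close> eigenvector of \<open>l\<close>. In the basis
    \<open>e\<close>, \<open>s f\<close> the matrix of \<open>l\<close> is therefore Z, and that of
    \<open>q\<close> swaps the two vectors up to the sign \<open>s\<close>.\<close>
  define f where "f = (\<lambda>x. pmat q x False * e False + pmat q x True * e True)"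
  define U where "U = (\<lambda>x y. if x then s * cnj (f y) else cnj (e y))"
  have "unitary1 U \<and> mul1 (mul1 U (pmat q)) (adj1 U) = (\<lambda>x y. s * pmat PX x y)
     \<and> mul1 (mul1 U (pmat l)) (adj1 U) = pmat PZ"
    using assms unfolding zero_pauli_def unitary1_def mul1_def adj1_def id1_def U_def f_def e_def fun_eq_iff all_bool_eq
    by (cases q; cases l)
       (auto simp add: id1_def h i mult.assoc mult.left_commute[of h \<i>])
  then show ?thesis by blast
qed

definition conj1 :: "op1 \<Rightarrow> op1 \<Rightarrow> op1" where
  "conj1 U A = mul1 (mul1 U A) (adj1 U)"

lemma conj1_mul1: "unitary1 U \<Longrightarrow> conj1 U (mul1 A B) = mul1 (conj1 U A) (conj1 U B)"
proof -
  assume "unitary1 U"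
  then have u: "mul1 (adj1 U) (mul1 U C) = C" for C
    by (simp add: unitary1_def flip: mul1_assoc)
  show ?thesis unfolding conj1_def mul1_assoc u ..
qed

lemma mul1_scale: "mul1 (\<lambda>x y. a * A x y) (\<lambda>x y. b * B x y) = (\<lambda>x y. a * b * mul1 A B x y)"
  by (simp add: mul1_def fun_eq_iff algebra_simps)

lemma conj1_scale: "conj1 U (\<lambda>x y. a * A x y) = (\<lambda>x y. a * conj1 U A x y)"
  by (simp add: conj1_def mul1_def fun_eq_iff algebra_simps)

lemma conj1_inverse:
  assumes "unitary1 U" shows "mul1 (mul1 (adj1 U) (conj1 U A)) U = A"
proof -
  have u: "mul1 (adj1 U) (mul1 U C) = C" for C
    using assms by (simp add: unitary1_def flip: mul1_assoc)
  show ?thesis using assms unfolding conj1_def mul1_assoc u by (simp add: unitary1_def)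
qed

lemma conj1_pmat_nonzero:
  assumes "unitary1 U" shows "\<exists>x y. conj1 U (pmat a) x y \<noteq> 0"
proof (rule ccontr)
  assume "\<nexists>x y. conj1 U (pmat a) x y \<noteq> 0"
  then have "conj1 U (pmat a) = (\<lambda>x y. 0)" by (simp add: fun_eq_iff)
  then have "pmat a = (\<lambda>x y. 0)" using conj1_inverse[OF assms, of "pmat a"] by (simp add: mul1_def)
  then show False using pmat_nonzero[of a] by simp
qed

text \<open>Conjugation fixes the identity and can be undone, so only the identity is sent to a
  multiple of the identity.\<close>

lemma conj1_pmat_eq_0_iff:
  assumes U: "unitary1 U" and a: "conj1 U (pmat a) = (\<lambda>x y. k * pmat g x y)" and "k \<noteq> 0"
  shows "a = 0 \<longleftrightarrow> g = 0"
proof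
  assume "a = 0"
  then have "id1 = (\<lambda>x y. k * pmat g x y)"
    using a U by (simp add: conj1_def unitary1_def zero_pauli_def)
  then show "g = 0" using pmat_prop_inj[of PI k g] by (simp add: zero_pauli_def)
next
  assume "g = 0"
  then have "conj1 U (pmat a) = (\<lambda>x y. k * id1 x y)" using a by (simp add: zero_pauli_def)
  then have "pmat a = (\<lambda>x y. k * mul1 (adj1 U) U x y)"
    using conj1_inverse[OF U, of "pmat a"] by (auto simp: mul1_def id1_def fun_eq_iff algebra_simps)
  then have "pmat a = (\<lambda>x y. k * pmat PI x y)" using U by (simp add: unitary1_def)
  then show "a = 0" using pmat_prop_inj[of a k PI] by (simp add: zero_pauli_def)
qed

lemma mul1_pmat_commute:
  "mul1 (pmat b) (pmat a) = (\<lambda>x y. (if sympl a b = 1 then -1 else 1) * mul1 (pmat a) (pmat b) x y)"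
  unfolding mul1_pmat phase_commute[of b a] by (simp only: add.commute[of b a] mult.assoc)

text \<open>Conjugation respects products, so it carries the sign from swapping two Paulis to their
  images; the product of the images is nonzero, so the sign can be read off. No Clifford property of
  \<open>U\<close> is assumed, only that these two images are Paulis up to a scalar.\<close>

lemma conj1_pmat_sympl:
  assumes U: "unitary1 U"
    and a: "conj1 U (pmat a) = (\<lambda>x y. k * pmat g x y)" "k \<noteq> 0"
    and b: "conj1 U (pmat b) = (\<lambda>x y. m * pmat h x y)" "m \<noteq> 0"
  shows "sympl a b = sympl g h"
proof -
  define sg where "sg v w = (if sympl v w = 1 then -1 else 1 :: complex)" for v w
  have gh: "conj1 U (mul1 (pmat a) (pmat b)) = (\<lambda>x y. k * m * mul1 (pmat g) (pmat h) x y)"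
    unfolding conj1_mul1[OF U] a(1) b(1) mul1_scale ..
  have "(\<lambda>x y. m * k * mul1 (pmat h) (pmat g) x y) = conj1 U (mul1 (pmat b) (pmat a))"
    unfolding conj1_mul1[OF U] a(1) b(1) mul1_scale ..
  also have "\<dots> = (\<lambda>x y. sg a b * (k * m * mul1 (pmat g) (pmat h) x y))"
    unfolding mul1_pmat_commute[of b a] conj1_scale gh sg_def ..
  finally have e: "m * k * (sg g h * mul1 (pmat g) (pmat h) x y) = sg a b * (k * m * mul1 (pmat g) (pmat h) x y)" for x y
    unfolding mul1_pmat_commute[of h g] sg_def[symmetric] by (rule fun_cong[OF fun_cong])
  obtain x y where "pmat (g + h) x y \<noteq> 0" using pmat_nonzero by blast
  then have "mul1 (pmat g) (pmat h) x y \<noteq> 0" by (simp add: mul1_pmat)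
  then have "sg g h = sg a b" using e[of x y] a(2) b(2) by simp
  then show ?thesis by (cases "sympl a b"; cases "sympl g h") (simp_all add: sg_def)
qed

section \<open>The rank of the pseudo-incidence matrix\<close>

lemma (in vec_space) dim_span_eq_card_iff:
  assumes "finite C" "C \<subseteq> carrier_vec n" "finite B" "B \<subseteq> carrier_vec n" "lin_indpt B" "C \<subseteq> span B"
  shows "vectorspace.dim class_ring (span_vs C) = card B \<longleftrightarrow> B \<subseteq> span C"
proof -
  let ?P = "\<lambda>T. T \<subseteq> B \<union> C \<and> lin_indpt T"
  have fin: "finite (B \<union> C)" and car: "B \<union> C \<subseteq> carrier_vec n" using assms by auto
  have out: "lin_indpt (insert v T)" if "T \<subseteq> carrier_vec n" "lin_indpt T" "v \<in> carrier_vec n" "v \<notin> span T" for v T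
    using lin_dep_iff_in_span[of T v] that span_mem[of T v] by auto
  \<comment> \<open>All of \<open>C\<close> lies in the span of \<open>B\<close>, so no vector of
    \<open>C\<close> can enlarge \<open>B\<close>; this fixes the dimension of the joint span as
    \<open>card B\<close>.\<close>
  have B: "maximal B ?P"
    unfolding maximal_def
  proof (intro conjI allI impI)
    show "B \<subseteq> B \<union> C" by simp
    show "lin_indpt B" by fact
    fix T assume T: "B \<subseteq> T \<and> T \<subseteq> B \<union> C \<and> lin_indpt T"
    show "T = B"
    proof (rule ccontr)
      assume "T \<noteq> B"
      then obtain v where v: "v \<in> T" "v \<notin> B" using T by auto
      then have "v \<in> span B" using T assms(6) by auto
      moreover have "lin_indpt (insert v B)" by (rule subset_li_is_li[of T]) (use T v in auto)
      ultimately show False using lin_dep_iff_in_span[of B v] v assms(2,4,5) T by auto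
    qed
  qed
  have dB: "vectorspace.dim class_ring (span_vs (B \<union> C)) = card B"
    by (rule dim_span) (use car fin B in auto)
  show ?thesis
  proof
    assume "B \<subseteq> span C"
    then have "B \<union> C \<subseteq> span C" using assms(2) in_own_span by auto
    then have "span (B \<union> C) \<subseteq> span C" using span_subsetI assms(2) by blast
    moreover have "span C \<subseteq> span (B \<union> C)" by (rule span_is_monotone) auto
    ultimately show "vectorspace.dim class_ring (span_vs C) = card B" using dB by simp
  next
    assume d: "vectorspace.dim class_ring (span_vs C) = card B"
    obtain U where U: "maximal U (\<lambda>T. T \<subseteq> C \<and> lin_indpt T)"
      using maximal_exists_superset[of C "\<lambda>T. T \<subseteq> C \<and> lin_indpt T" "{}"] assms(1)
      by (auto simp: lin_dep_def)
    then have UC: "U \<subseteq> C" "lin_indpt U" by (auto simp: maximal_def)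
    have cU: "card U = card B"
      using dim_span[of C U] U assms(1,2) d by auto
    show "B \<subseteq> span C"
    proof (rule ccontr)
      assume "\<not> B \<subseteq> span C"
      then obtain b where b: "b \<in> B" "b \<notin> span C" by auto
      then have bU: "b \<notin> span U" using span_is_monotone[OF UC(1)] by auto
      then have "b \<notin> U" using UC assms(2) span_mem[of U b] by auto
      \<comment> \<open>A maximal independent subset \<open>U\<close> of \<open>C\<close> already
        has \<open>card B\<close> elements. Adding a vector outside its span would give an
        independent subset of \<open>B \<union> C\<close> that is too large.\<close>
      have "lin_indpt (insert b U)"
        by (rule out) (use UC assms b bU in auto)
      then have "?P (insert b U)" using UC b by auto
      then obtain V where V: "finite V" "maximal V ?P" "insert b U \<subseteq> V"
        using maximal_exists_superset[of "B \<union> C" ?P "insert b U"] fin by auto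
      have "card V = card B"
        using dim_span[of "B \<union> C" V] V(2) car fin dB by auto
      moreover have "card (insert b U) \<le> card V" using V by (auto intro: card_mono)
      moreover have "card (insert b U) = Suc (card U)"
        using \<open>b \<notin> U\<close> UC assms(1) by (auto intro: card_insert_disjoint dest: finite_subset)
      ultimately show False using cU by simp
    qed
  qed
qed

section \<open>Columns of the pseudo-incidence matrix and their span\<close>

text \<open>The column of the pair \<open>i\<close>, \<open>j\<close>, made available for all index
  pairs and not only for \<open>i < j\<close>, so that bilinearity can be applied freely.\<close>

definition comm_vec :: "nat \<Rightarrow> (nat \<Rightarrow> nat \<Rightarrow> pauli) \<Rightarrow> nat \<Rightarrow> nat \<Rightarrow> bit vec" where
  "comm_vec N p i j = vec N (\<lambda>\<mu>. sympl (p i \<mu>) (p j \<mu>))"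

lemma set_pairs_list: "set (pairs_list n) = {(i, j). i < j \<and> j < n}"
  by (force simp: pairs_list_def)

lemma cols_pseudo_incidence:
  "set (cols (pseudo_incidence N n p)) = {comm_vec N p i j | i j. i < j \<and> j < n}"
proof -
  have "col (pseudo_incidence N n p) l = (\<lambda>(i, j). comm_vec N p i j) (pairs_list n ! l)"
    if "l < length (pairs_list n)" for l
    using that by (auto simp: pseudo_incidence_def comm_vec_def anticomm1_iff split: prod.split)
  moreover have "set (cols (pseudo_incidence N n p)) = col (pseudo_incidence N n p) ` {..<length (pairs_list n)}"
    by (simp add: cols_def pseudo_incidence_def atLeast0LessThan)
  moreover have "set (pairs_list n) = (!) (pairs_list n) ` {..<length (pairs_list n)}"
    by (auto simp: set_conv_nth)
  ultimately have "set (cols (pseudo_incidence N n p)) = (\<lambda>(i, j). comm_vec N p i j) ` set (pairs_list n)"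
    by (simp add: image_image)
  then show ?thesis by (auto simp: set_pairs_list)
qed

lemma (in vec_space) zero_in_span: "0\<^sub>v n \<in> span W"
  unfolding span_def lincomb_def by (auto intro!: exI[of _ "{}"])

text \<open>The simplifier rewrites the field operations of \<^typ>\<open>bit\<close> inside
  \<^term>\<open>class_ring\<close>; a constant for the span keeps them out of its reach.\<close>
definition span_F2 :: "nat \<Rightarrow> bit vec set \<Rightarrow> bit vec set" where
  "span_F2 N W = LinearCombinations.module.span class_ring (module_vec TYPE(bit) N) W"

context
  fixes N :: nat
begin

interpretation vec_space "TYPE(bit)" N .

lemma span_F2_zero: "0\<^sub>v N \<in> span_F2 N W"
  unfolding span_F2_def by (rule zero_in_span)

lemma span_F2_add: "W \<subseteq> carrier_vec N \<Longrightarrow> u \<in> span_F2 N W \<Longrightarrow> v \<in> span_F2 N W \<Longrightarrow> u + v \<in> span_F2 N W"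
  unfolding span_F2_def using span_add1[of W u v] by (simp only: module_vec_simps)

lemma span_F2_mem: "W \<subseteq> carrier_vec N \<Longrightarrow> v \<in> W \<Longrightarrow> v \<in> span_F2 N W"
  unfolding span_F2_def using span_mem[of W v] by (simp only: module_vec_simps)

lemma span_F2_subsetI: "W \<subseteq> carrier_vec N \<Longrightarrow> W' \<subseteq> span_F2 N W \<Longrightarrow> span_F2 N W' \<subseteq> span_F2 N W"
  unfolding span_F2_def by (rule span_subsetI)

lemma rank_F2_cong: "span_F2 N (set (cols A)) = span_F2 N (set (cols B)) \<Longrightarrow> rank_F2 N A = rank_F2 N B"
  unfolding rank_F2_def rank_def span_F2_def by (simp only:)

text \<open>Adding up the coordinates in \<open>K\<close> is a linear functional. It will serve to
  show that a vector is outside a span.\<close>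

lemma span_F2_sum_eq_0:
  assumes "v \<in> span_F2 N W" "W \<subseteq> carrier_vec N" "K \<subseteq> {..<N}" "\<And>w. w \<in> W \<Longrightarrow> (\<Sum>\<mu>\<in>K. w $ \<mu>) = 0"
  shows "(\<Sum>\<mu>\<in>K. v $ \<mu>) = 0"
proof -
  obtain c A where A: "v = lincomb c A" "A \<subseteq> W"
    using in_spanE[OF assms(1)[unfolded span_F2_def]] by blast
  have "(\<Sum>\<mu>\<in>K. v $ \<mu>) = (\<Sum>\<mu>\<in>K. \<Sum>x\<in>A. c x * x $ \<mu>)"
    unfolding A(1) by (rule sum.cong[OF refl], rule lincomb_index) (use assms A in auto)
  also have "\<dots> = (\<Sum>x\<in>A. c x * (\<Sum>\<mu>\<in>K. x $ \<mu>))"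
    by (subst sum.swap) (simp only: sum_distrib_left)
  also have "\<dots> = 0" using A assms(4) by (intro sum.neutral) (metis mult_zero_right subsetD)
  finally show ?thesis .
qed

text \<open>Each member of \<^term>\<open>B\<close> has a private coordinate, so \<^term>\<open>B\<close> is linearly independent.\<close>
lemma rank_F2_eq_card_iff:
  assumes A: "A \<in> carrier_mat N k" and B: "finite B" "B \<subseteq> carrier_vec N"
    and d: "\<And>v. v \<in> B \<Longrightarrow> d v < N"
    and dual: "\<And>v w. v \<in> B \<Longrightarrow> w \<in> B \<Longrightarrow> w $ d v = (if w = v then 1 else 0)"
    and sub: "set (cols A) \<subseteq> span_F2 N B"
  shows "rank_F2 N A = card B \<longleftrightarrow> B \<subseteq> span_F2 N (set (cols A))"
proof -
  have li: "lin_indpt B"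
  proof (rule finite_lin_indpt2)
    fix c assume z: "lincomb c B = 0\<^sub>v N"
    show "\<forall>v\<in>B. c v = 0"
    proof
      fix v assume v: "v \<in> B"
      have "0 = lincomb c B $ d v" using z d[OF v] by simp
      also have "\<dots> = (\<Sum>x\<in>B. c x * x $ d v)" by (rule lincomb_index[OF d[OF v] B(2)])
      also have "\<dots> = (\<Sum>x\<in>B. if x = v then c v else 0)"
        by (rule sum.cong) (use v in \<open>auto simp: dual\<close>)
      also have "\<dots> = c v" using v B by simp
      finally show "c v = 0" by simp
    qed
  qed (use B in auto)
  have "set (cols A) \<subseteq> carrier_vec N" using A cols_dim by blast
  from dim_span_eq_card_iff[OF finite_set this B li sub[unfolded span_F2_def]]
  show ?thesis unfolding rank_F2_def rank_def span_F2_def .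
qed

end

lemma span_F2_vec_sum:
  assumes "W \<subseteq> carrier_vec N" "finite T" "\<And>k. k \<in> T \<Longrightarrow> vec N (f k) \<in> span_F2 N W"
  shows "vec N (\<lambda>\<mu>. \<Sum>k\<in>T. f k \<mu>) \<in> span_F2 N W"
  using assms(2,3)
proof (induction T)
  case empty
  have "vec N (\<lambda>\<mu>. 0 :: bit) = 0\<^sub>v N" by auto
  then show ?case unfolding sum.empty by (simp only: span_F2_zero)
next
  case (insert k T)
  have "vec N (\<lambda>\<mu>. \<Sum>k\<in>insert k T. f k \<mu>) = vec N (f k) + vec N (\<lambda>\<mu>. \<Sum>k\<in>T. f k \<mu>)"
    using insert by auto
  then show ?case using span_F2_add[OF assms(1)] insert by auto
qed

text \<open>By bilinearity, the commutation vector of two products is the sum of the commutation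
  vectors of their factors. Applied to mutually inverse substitutions, this gives equality of the
  spans.\<close>

lemma span_cols_mono:
  assumes "\<And>i \<mu>. i < n \<Longrightarrow> \<mu> < N \<Longrightarrow> p i \<mu> = (\<Sum>k\<in>T i. s k \<mu>)" "\<And>i. i < n \<Longrightarrow> T i \<subseteq> {..<n}"
  shows "span_F2 N (set (cols (pseudo_incidence N n p))) \<subseteq> span_F2 N (set (cols (pseudo_incidence N n s)))"
proof (rule span_F2_subsetI)
  let ?W = "set (cols (pseudo_incidence N n s))"
  show W: "?W \<subseteq> carrier_vec N"
    by (auto simp: cols_pseudo_incidence comm_vec_def)
  \<comment> \<open>Expanding products also produces equal and descending index pairs: the former
    give zero, the latter are columns by symmetry.\<close>
  have base: "comm_vec N s k l \<in> span_F2 N ?W" if "k < n" "l < n" for k l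
  proof -
    have "comm_vec N s k k = 0\<^sub>v N" by (auto simp: comm_vec_def)
    moreover have "comm_vec N s k l = comm_vec N s l k" by (auto simp: comm_vec_def sympl_commute)
    moreover have "comm_vec N s k l \<in> span_F2 N ?W" if "k < l" "l < n" for k l
      using that by (intro span_F2_mem[OF W]) (auto simp: cols_pseudo_incidence)
    ultimately show ?thesis
      using that span_F2_zero by (metis linorder_neqE_nat)
  qed
  have "comm_vec N p i j \<in> span_F2 N ?W" if "i < n" "j < n" for i j
  proof -
    have fin: "finite (T i)" "finite (T j)" using assms(2) that finite_subset by blast+
    have "comm_vec N p i j = vec N (\<lambda>\<mu>. \<Sum>k\<in>T i. \<Sum>l\<in>T j. sympl (s k \<mu>) (s l \<mu>))"
      unfolding comm_vec_def
      by (rule eq_vecI) (simp_all add: assms(1) that sympl_sum_left sympl_sum_right, rule sum.swap)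
    also have "\<dots> \<in> span_F2 N ?W"
      using base assms(2) that fin W unfolding comm_vec_def
      by (intro span_F2_vec_sum) blast+
    finally show ?thesis .
  qed
  then show "set (cols (pseudo_incidence N n p)) \<subseteq> span_F2 N ?W"
    by (auto simp: cols_pseudo_incidence)
qed

lemma rank_F2_cong_span:
  assumes "\<And>i \<mu>. i < n \<Longrightarrow> \<mu> < N \<Longrightarrow> p i \<mu> = (\<Sum>k\<in>T i. s k \<mu>)" "\<And>i. i < n \<Longrightarrow> T i \<subseteq> {..<n}"
    "\<And>i \<mu>. i < n \<Longrightarrow> \<mu> < N \<Longrightarrow> s i \<mu> = (\<Sum>k\<in>T' i. p k \<mu>)" "\<And>i. i < n \<Longrightarrow> T' i \<subseteq> {..<n}"
  shows "rank_F2 N (pseudo_incidence N n p) = rank_F2 N (pseudo_incidence N n s)"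
proof -
  have "span_F2 N (set (cols (pseudo_incidence N n p))) = span_F2 N (set (cols (pseudo_incidence N n s)))"
    using span_cols_mono[where p = p and s = s and T = T, OF assms(1,2)]
      span_cols_mono[where p = s and s = p and T = T', OF assms(3,4)] by blast
  then show ?thesis by (rule rank_F2_cong)
qed

text \<open>The hypothesis on \<open>p\<close> makes the columns the edge vectors of the induced
  graph, together with zero columns for non-adjacent pairs. Their span is compared with that of a
  star centred at a vertex \<open>m\<close>.\<close>

lemma rank_F2_graph:
  assumes bij: "bij_betw f {..<n} \<Omega>" and sub: "\<Omega> \<subseteq> {..<N}" and ne: "\<Omega> \<noteq> {}"
    and sym: "\<And>u v. E u v \<Longrightarrow> E v u \<and> u \<noteq> v"
    and p: "\<And>i j \<mu>. i < n \<Longrightarrow> j < n \<Longrightarrow> \<mu> < N \<Longrightarrow>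
      sympl (p i \<mu>) (p j \<mu>) = (if E (f i) (f j) \<and> (\<mu> = f i \<or> \<mu> = f j) then 1 else 0)"
  shows "rank_F2 N (pseudo_incidence N n p) = n - 1 \<longleftrightarrow> induced_connected E \<Omega>"
proof -
  define R where "R = {(a, b). a \<in> \<Omega> \<and> b \<in> \<Omega> \<and> E a b}"
  \<comment> \<open>The sum of the unit vectors at \<open>a\<close> and \<open>b\<close>; comparing
    the two equations makes it zero for \<open>a = b\<close>.\<close>
  define ed where "ed a b = vec N (\<lambda>\<mu>. if (\<mu> = a) = (\<mu> = b) then 0 else 1 :: bit)" for a b
  define C where "C = set (cols (pseudo_incidence N n p))"
  have C: "finite C" "C \<subseteq> carrier_vec N"
    by (auto simp: C_def) (auto simp: cols_pseudo_incidence comm_vec_def)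
  have cv: "comm_vec N p i j = (if E (f i) (f j) then ed (f i) (f j) else 0\<^sub>v N)" if "i < n" "j < n" for i j
    using that sym by (auto simp: comm_vec_def ed_def p)
  have cv_mem: "ed a b \<in> span_F2 N C" if "(a, b) \<in> R" for a b
  proof -
    have "a \<in> f ` {..<n}" "b \<in> f ` {..<n}" using that bij by (auto simp: R_def bij_betw_def)
    then obtain i j where ij: "i < n" "j < n" "a = f i" "b = f j" by blast
    have "ed a b = ed b a" by (auto simp: ed_def)
    then have "ed a b \<in> C"
      using ij that sym[of a b] cv[of i j] cv[of j i]
      by (cases i j rule: linorder_cases) (force simp: C_def cols_pseudo_incidence R_def)+
    then show ?thesis using C span_F2_mem by auto
  qed
  obtain m where m: "m \<in> \<Omega>" using ne by auto
  \<comment> \<open>The \<open>n - 1\<close> rays of the star from \<open>m\<close> to the other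
    vertices form a basis of the vectors on \<Omega> with coordinate sum zero.\<close>
  define B where "B = ed m ` (\<Omega> - {m})"
  have fin: "finite \<Omega>" using sub finite_subset by auto
  have idx: "ed m a $ b = (if a = b then 1 else 0)" if "a \<in> \<Omega> - {m}" "b \<in> \<Omega> - {m}" for a b
    using that sub by (auto simp: ed_def)
  have inj: "inj_on (ed m) (\<Omega> - {m})"
    by (rule inj_onI) (metis idx zero_neq_one)
  have "card B = card \<Omega> - 1"
    using m fin by (simp add: B_def card_image[OF inj])
  then have cB: "card B = n - 1" using bij_betw_same_card[OF bij] by simp
  have B: "finite B" "B \<subseteq> carrier_vec N" using fin by (auto simp: B_def ed_def)
  have ed_tri: "ed a b = ed m a + ed m b" for a b
    by (rule eq_vecI) (auto simp: ed_def)
  have ed_B: "ed m a \<in> span_F2 N B" if "a \<in> \<Omega>" for a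
  proof (cases "a = m")
    case True
    then have "ed m a = 0\<^sub>v N" by (auto simp: ed_def)
    then show ?thesis using span_F2_zero by simp
  next
    case False
    then show ?thesis using B that span_F2_mem by (auto simp: B_def)
  qed
  have CB: "C \<subseteq> span_F2 N B"
  proof
    fix v assume "v \<in> C"
    then obtain i j where ij: "i < j" "j < n" "v = comm_vec N p i j"
      by (auto simp: C_def cols_pseudo_incidence)
    then have "i < n" by simp
    then have "f i \<in> \<Omega>" "f j \<in> \<Omega>" using bij ij by (auto simp: bij_betw_def)
    then have "ed (f i) (f j) \<in> span_F2 N B"
      unfolding ed_tri[of "f i" "f j"] using span_F2_add B ed_B by auto
    then show "v \<in> span_F2 N B" using ij \<open>i < n\<close> cv[of i j] span_F2_zero by auto
  qed
  \<comment> \<open>The private coordinate of a ray is its end away from \<open>m\<close>.\<close>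
  define d where "d v = (SOME a. a \<in> \<Omega> - {m} \<and> ed m a = v)" for v
  have d: "d v \<in> \<Omega> - {m} \<and> ed m (d v) = v" if "v \<in> B" for v
    using that unfolding d_def B_def by (elim imageE) (rule someI_ex, blast)
  have dN: "d v < N" if "v \<in> B" for v
    using d[OF that] sub by auto
  have dual: "w $ d v = (if w = v then 1 else 0)" if "v \<in> B" "w \<in> B" for v w
    using idx[of "d w" "d v"] d[OF that(1)] d[OF that(2)] by auto
  have "rank_F2 N (pseudo_incidence N n p) = n - 1 \<longleftrightarrow> B \<subseteq> span_F2 N C"
    unfolding C_def cB[symmetric]
    by (rule rank_F2_eq_card_iff[where d = d])
       (use B CB dN dual in \<open>auto simp: C_def pseudo_incidence_def\<close>)
  also have "\<dots> \<longleftrightarrow> induced_connected E \<Omega>"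
  proof
    assume BC: "B \<subseteq> span_F2 N C"
    \<comment> \<open>Summing the coordinates over the component of \<open>m\<close> annihilates
      every edge vector, since no edge leaves the component, but gives \<open>1\<close> on the ray
      to an unreachable vertex.\<close>
    define K where "K = {a \<in> \<Omega>. (m, a) \<in> R\<^sup>*}"
    have K: "finite K" "m \<in> K" "K \<subseteq> {..<N}" using fin m sub by (auto simp: K_def)
    have edK: "(\<Sum>\<mu>\<in>K. ed a b $ \<mu>) = (if a \<in> K \<longleftrightarrow> b \<in> K then 0 else 1)" for a b
    proof -
      have "(\<Sum>\<mu>\<in>K. ed a b $ \<mu>) = (\<Sum>\<mu>\<in>K. (if \<mu> = a then 1 else 0) + (if \<mu> = b then 1 else 0))"
        by (rule sum.cong) (use K in \<open>auto simp: ed_def\<close>)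
      also have "\<dots> = (\<Sum>\<mu>\<in>K. if \<mu> = a then 1 else 0) + (\<Sum>\<mu>\<in>K. if \<mu> = b then 1 else 0)"
        by (rule sum.distrib)
      also have "\<dots> = (if a \<in> K then 1 else 0) + (if b \<in> K then 1 else 0)"
        using K by simp
      finally show ?thesis by simp
    qed
    have CK: "(\<Sum>\<mu>\<in>K. v $ \<mu>) = 0" if vC: "v \<in> C" for v
    proof -
      obtain i j where "i < j" and ij: "j < n" "v = comm_vec N p i j"
        using vC by (auto simp: C_def cols_pseudo_incidence)
      then have ij: "i < n" "j < n" "v = comm_vec N p i j" by auto
      then have fij: "f i \<in> \<Omega>" "f j \<in> \<Omega>" using bij by (auto simp: bij_betw_def)
      show ?thesis
      proof (cases "E (f i) (f j)")
        case True
        then have "(f i, f j) \<in> R" "(f j, f i) \<in> R" using fij sym by (auto simp: R_def)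
        then have "f i \<in> K \<longleftrightarrow> f j \<in> K" using fij
          by (auto simp: K_def intro: rtrancl_into_rtrancl)
        then show ?thesis using True ij cv by (simp add: edK)
      next
        case False
        have "(\<Sum>\<mu>\<in>K. 0\<^sub>v N $ \<mu>) = (0 :: bit)" using K(3) by (intro sum.neutral) auto
        then show ?thesis using False ij cv by simp
      qed
    qed
    have SK: "(\<Sum>\<mu>\<in>K. v $ \<mu>) = 0" if "v \<in> span_F2 N C" for v
      using span_F2_sum_eq_0[OF that C(2) K(3) CK] .
    have reach: "(m, a) \<in> R\<^sup>*" if "a \<in> \<Omega>" for a
    proof (cases "a = m")
      case False
      then have "ed m a \<in> span_F2 N C" using BC that by (auto simp: B_def)
      then show ?thesis using SK[of "ed m a"] edK[of m a] K by (auto simp: K_def split: if_splits)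
    qed simp
    have "sym R" using sym by (auto simp: R_def sym_def)
    then have "sym (R\<^sup>*)" by (rule sym_rtrancl)
    then have "(u, v) \<in> R\<^sup>*" if "u \<in> \<Omega>" "v \<in> \<Omega>" for u v
      using reach that by (meson symD rtrancl_trans)
    then show "induced_connected E \<Omega>" by (simp add: induced_connected_def R_def)
  next
    assume conn: "induced_connected E \<Omega>"
    have CC: "C \<subseteq> carrier_vec N" by (rule C)
    have "ed m a \<in> span_F2 N C" if "(m, a) \<in> R\<^sup>*" for a
      using that
    proof (induction)
      case base
      have "ed m m = 0\<^sub>v N" by (auto simp: ed_def)
      then show ?case using span_F2_zero by simp
    next
      case (step a b)
      \<comment> \<open>Along a path the edge vectors telescope to the ray from \<open>m\<close> to
        its last vertex.\<close>
      have "ed m b = ed m a + ed a b" by (rule eq_vecI) (auto simp: ed_def)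
      then show ?case using span_F2_add[OF CC] step cv_mem by auto
    qed
    then show "B \<subseteq> span_F2 N C" using conn m by (auto simp: B_def induced_connected_def R_def)
  qed
  finally show ?thesis .
qed

section \<open>Graph form over the two-element field\<close>

lemma sum_sympl_sums_eq_0:
  assumes "\<And>i j. i \<in> T \<Longrightarrow> j \<in> T' \<Longrightarrow> (\<Sum>\<mu>\<in>Q. sympl (s i \<mu>) (s j \<mu>)) = 0"
  shows "(\<Sum>\<mu>\<in>Q. sympl (\<Sum>i\<in>T. s i \<mu>) (\<Sum>j\<in>T'. s j \<mu>)) = 0"
proof -
  have "(\<Sum>\<mu>\<in>Q. sympl (\<Sum>i\<in>T. s i \<mu>) (\<Sum>j\<in>T'. s j \<mu>)) = (\<Sum>\<mu>\<in>Q. \<Sum>i\<in>T. \<Sum>j\<in>T'. sympl (s i \<mu>) (s j \<mu>))"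
    unfolding sympl_sum_left unfolding sympl_sum_right ..
  also have "\<dots> = (\<Sum>i\<in>T. \<Sum>\<mu>\<in>Q. \<Sum>j\<in>T'. sympl (s i \<mu>) (s j \<mu>))"
    by (rule sum.swap)
  also have "\<dots> = (\<Sum>i\<in>T. \<Sum>j\<in>T'. \<Sum>\<mu>\<in>Q. sympl (s i \<mu>) (s j \<mu>))"
    by (rule sum.cong[OF refl], rule sum.swap)
  also have "\<dots> = 0"
    by (rule sum.neutral, rule ballI, rule sum.neutral, rule ballI, rule assms)
  finally show ?thesis .
qed

lemma pauli_avoid: "\<exists>l. l \<noteq> 0 \<and> l \<noteq> (v :: pauli)"
  by (cases v) (auto simp: zero_pauli_def intro: exI[of _ PX] exI[of _ PY])

text \<open>The Paulis commuting with a nonzero \<open>l\<close> are \<open>0\<close> and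
  \<open>l\<close>, and these commute with each other.\<close>

lemma sympl_same_line: "sympl l a = 0 \<Longrightarrow> sympl l b = 0 \<Longrightarrow> l \<noteq> 0 \<Longrightarrow> sympl a b = 0"
  by (auto simp: sympl_def split: if_splits)

text \<open>Qubits are treated one at a time. The products allowed by the lines chosen so far and supported
  off the later qubits commute there, hence on the new qubit as well, so they
  reduce to \<^term>\<open>{0, v}\<close> on it, and any line other than \<^term>\<open>v\<close> can be chosen.\<close>
lemma transversal_lines:
  assumes fin: "finite \<Omega>"
    and ind: "\<And>T. T \<subseteq> {..<n} \<Longrightarrow> T \<noteq> {} \<Longrightarrow> \<exists>\<mu>\<in>\<Omega>. (\<Sum>j\<in>T. s j \<mu>) \<noteq> 0"
    and comm: "\<And>i j. i < n \<Longrightarrow> j < n \<Longrightarrow> (\<Sum>\<mu>\<in>\<Omega>. sympl (s i \<mu>) (s j \<mu>)) = 0"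
  shows "\<exists>l. (\<forall>\<mu>. l \<mu> \<noteq> 0) \<and>
    (\<forall>T. T \<subseteq> {..<n} \<and> T \<noteq> {} \<longrightarrow> (\<exists>\<mu>\<in>\<Omega>. sympl (l \<mu>) (\<Sum>j\<in>T. s j \<mu>) \<noteq> 0))"
proof -
  define tot where "tot T \<mu> = (\<Sum>j\<in>T. s j \<mu>)" for T \<mu>
  \<comment> \<open>The invariant interpolates between independence on \<Omega>, at
    \<open>K = {}\<close>, and the claim, at \<open>K = \<Omega>\<close>.\<close>
  have "\<exists>l. (\<forall>\<mu>. l \<mu> \<noteq> 0) \<and> (\<forall>T. T \<subseteq> {..<n} \<and> T \<noteq> {} \<longrightarrow>
      (\<exists>\<mu>\<in>K. sympl (l \<mu>) (tot T \<mu>) \<noteq> 0) \<or> (\<exists>\<mu>\<in>\<Omega> - K. tot T \<mu> \<noteq> 0))"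
    if "finite K" "K \<subseteq> \<Omega>" for K
    using that
  proof (induction K)
    case empty
    have "PX \<noteq> 0" by (simp add: zero_pauli_def)
    then show ?case using ind by (intro exI[of _ "\<lambda>_. PX"]) (auto simp: tot_def)
  next
    case (insert \<nu> K)
    from insert.prems have "K \<subseteq> \<Omega>" by simp
    from insert.IH[OF this] obtain l where l: "\<forall>\<mu>. l \<mu> \<noteq> 0" and IH: "\<forall>T. T \<subseteq> {..<n} \<and> T \<noteq> {} \<longrightarrow>
      (\<exists>\<mu>\<in>K. sympl (l \<mu>) (tot T \<mu>) \<noteq> 0) \<or> (\<exists>\<mu>\<in>\<Omega> - K. tot T \<mu> \<noteq> 0)"
      by (elim exE conjE)
    define F where "F = {T. T \<subseteq> {..<n} \<and> T \<noteq> {} \<and> (\<forall>\<mu>\<in>K. sympl (l \<mu>) (tot T \<mu>) = 0)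
       \<and> (\<forall>\<mu>\<in>\<Omega> - insert \<nu> K. tot T \<mu> = 0)}"
    have nz: "tot T \<nu> \<noteq> 0" if "T \<in> F" for T
      using IH[rule_format, of T] that unfolding F_def by auto
    have same: "tot T \<nu> = tot T' \<nu>" if T: "T \<in> F" "T' \<in> F" for T T'
    proof -
      have "0 = (\<Sum>\<mu>\<in>\<Omega>. sympl (tot T \<mu>) (tot T' \<mu>))"
        unfolding tot_def by (rule sum_sympl_sums_eq_0[where s = s, symmetric]) (use T comm in \<open>auto simp: F_def\<close>)
      also have "\<dots> = sympl (tot T \<nu>) (tot T' \<nu>) + (\<Sum>\<mu>\<in>\<Omega> - {\<nu>}. sympl (tot T \<mu>) (tot T' \<mu>))"
        using fin insert.prems by (intro sum.remove) auto
      also have "(\<Sum>\<mu>\<in>\<Omega> - {\<nu>}. sympl (tot T \<mu>) (tot T' \<mu>)) = 0"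
      proof (intro sum.neutral ballI)
        fix \<mu> assume "\<mu> \<in> \<Omega> - {\<nu>}"
        then show "sympl (tot T \<mu>) (tot T' \<mu>) = 0"
          using T l[rule_format, of \<mu>] sympl_same_line[of "l \<mu>" "tot T \<mu>" "tot T' \<mu>"]
          by (cases "\<mu> \<in> K") (auto simp: F_def)
      qed
      finally show ?thesis using nz T by (auto simp: sympl_def split: if_splits)
    qed
    \<comment> \<open>If \<open>F\<close> is empty, \<open>v\<close> is arbitrary and the statement
      about members of \<open>F\<close> is vacuous.\<close>
    define v where "v = tot (SOME T. T \<in> F) \<nu>"
    have v: "tot T \<nu> = v" if "T \<in> F" for T
      unfolding v_def using that by (rule same) (rule someI[of "\<lambda>T. T \<in> F", OF that])
    obtain a where a: "a \<noteq> 0" "a \<noteq> v" using pauli_avoid by blast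
    define l' where "l' = l(\<nu> := a)"
    have "(\<exists>\<mu>\<in>insert \<nu> K. sympl (l' \<mu>) (tot T \<mu>) \<noteq> 0) \<or> (\<exists>\<mu>\<in>\<Omega> - insert \<nu> K. tot T \<mu> \<noteq> 0)"
      if T: "T \<subseteq> {..<n}" "T \<noteq> {}" for T
    proof (cases "T \<in> F")
      case True
      then have "sympl (l' \<nu>) (tot T \<nu>) \<noteq> 0"
        using nz[OF True] v[OF True] a by (auto simp: l'_def sympl_def)
      then show ?thesis by blast
    next
      case False
      then consider \<mu> where "\<mu> \<in> K" "sympl (l \<mu>) (tot T \<mu>) \<noteq> 0" | "\<exists>\<mu>\<in>\<Omega> - insert \<nu> K. tot T \<mu> \<noteq> 0"
        using T unfolding F_def by blast
      then show ?thesis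
      proof cases
        case 1
        then have "sympl (l' \<mu>) (tot T \<mu>) \<noteq> 0" using insert.hyps by (auto simp: l'_def)
        then show ?thesis using 1 by blast
      qed blast
    qed
    moreover have "\<And>\<mu>. l' \<mu> \<noteq> 0" using l a by (simp add: l'_def)
    ultimately show ?case by blast
  qed
  from this[OF fin order_refl] show ?thesis by (simp add: tot_def)
qed

section \<open>Binary matrices acting on products of Paulis\<close>

lemma sum_bit_mult: "finite A \<Longrightarrow> (\<Sum>k\<in>A. r k * a k :: bit) = (\<Sum>k\<in>{k \<in> A. r k = 1}. a k)"
proof -
  assume "finite A"
  then have "(\<Sum>k\<in>{k \<in> A. r k = 1}. a k) = (\<Sum>k\<in>A. if r k = 1 then a k else 0)"
    by (rule sum.inter_filter)
  also have "\<dots> = (\<Sum>k\<in>A. r k * a k)"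
  proof (rule sum.cong[OF refl])
    show "(if r k = 1 then a k else 0) = r k * a k" for k by (cases "r k") simp_all
  qed
  finally show ?thesis ..
qed

text \<open>Over the two-element field a linear combination of rows is a sum over a subset, so
  \<open>ind\<close> is row independence: the support of a kernel vector of the transpose would
  violate it.\<close>

lemma bit_mat_left_inverse:
  fixes A :: "bit mat"
  assumes A: "A \<in> carrier_mat n n"
    and ind: "\<And>T. T \<subseteq> {..<n} \<Longrightarrow> T \<noteq> {} \<Longrightarrow> \<exists>j<n. (\<Sum>i\<in>T. A $$ (i, j)) \<noteq> 0"
  obtains R where "R \<in> carrier_mat n n" "invertible_mat R" "R * A = 1\<^sub>m n"
proof -
  have "det (transpose_mat A) \<noteq> 0"
  proof
    assume "det (transpose_mat A) = 0"
    then obtain v where v: "v \<in> carrier_vec n" "v \<noteq> 0\<^sub>v n" "transpose_mat A *\<^sub>v v = 0\<^sub>v n"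
      using det_0_iff_vec_prod_zero[of "transpose_mat A" n] A by auto
    define T where "T = {i \<in> {..<n}. v $ i = 1}"
    have "T \<noteq> {}"
    proof
      assume "T = {}"
      then have "v = 0\<^sub>v n" using v(1) by (intro eq_vecI) (auto simp: T_def)
      then show False using v by simp
    qed
    then obtain j where j: "j < n" "(\<Sum>i\<in>T. A $$ (i, j)) \<noteq> 0" using ind[of T] by (auto simp: T_def)
    have "0 = (transpose_mat A *\<^sub>v v) $ j" using v(3) j by simp
    also have "\<dots> = (\<Sum>i\<in>{..<n}. v $ i * A $$ (i, j))"
      using A v(1) j by (simp add: scalar_prod_def atLeast0LessThan conj_commute)
    also have "\<dots> = (\<Sum>i\<in>T. A $$ (i, j))"
      unfolding T_def by (rule sum_bit_mult) simp
    finally show False using j by simp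
  qed
  then have "det A \<noteq> 0" using det_transpose[OF A] by simp
  then have "A \<in> Units (ring_mat TYPE(bit) n ())" by (rule det_non_zero_imp_unit[OF A])
  then obtain R where R: "R \<in> carrier_mat n n" "R * A = 1\<^sub>m n" "A * R = 1\<^sub>m n"
    by (auto simp: Units_def ring_mat_def)
  then have "invertible_mat R"
    using A by (auto simp: invertible_mat_def inverts_mat_def intro!: exI[of _ A])
  then show ?thesis using R that by blast
qed

text \<open>The conditional stands for the scalar multiple of a Pauli by a bit; only the parity of
  the number of copies counts.\<close>

lemma sum_pauli_if_bit: "(\<Sum>i\<in>A. if b i = (1 :: bit) then a else 0) = (if (\<Sum>i\<in>A. b i) = 1 then a else (0 :: pauli))"
proof (induction A rule: infinite_finite_induct)
  case (insert x A)
  then show ?case by (cases "b x"; cases "sum b A") simp_all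
qed simp_all

definition row_supp :: "nat \<Rightarrow> bit mat \<Rightarrow> nat \<Rightarrow> nat set" where
  "row_supp n R i = {j. j < n \<and> R $$ (i, j) = 1}"

lemma row_supp_subset: "row_supp n R i \<subseteq> {..<n}" "finite (row_supp n R i)"
  by (auto simp: row_supp_def)

lemma sum_row_supp: "(\<Sum>j\<in>row_supp n R i. a j) = (\<Sum>j<n. if R $$ (i, j) = 1 then a j else (0 :: pauli))"
proof -
  have "row_supp n R i = {j \<in> {..<n}. R $$ (i, j) = 1}" by (auto simp: row_supp_def)
  then show ?thesis by (simp only: sum.inter_filter finite_lessThan)
qed

text \<open>Taking products of products corresponds to multiplying the coefficient row
  \<open>t\<close> by the matrix \<open>R\<close>.\<close>

lemma sum_row_supp_combination:
  fixes s :: "nat \<Rightarrow> pauli"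
  shows "(\<Sum>i<n. if t i = (1 :: bit) then \<Sum>j\<in>row_supp n R i. s j else 0)
    = (\<Sum>j<n. if (\<Sum>i<n. t i * R $$ (i, j)) = 1 then s j else 0)"
proof -
  have "(\<Sum>i<n. if t i = 1 then \<Sum>j\<in>row_supp n R i. s j else 0)
      = (\<Sum>i<n. \<Sum>j<n. if t i * R $$ (i, j) = 1 then s j else 0)"
    unfolding sum_row_supp by (rule sum.cong) auto
  also have "\<dots> = (\<Sum>j<n. \<Sum>i<n. if t i * R $$ (i, j) = 1 then s j else 0)"
    by (rule sum.swap)
  finally show ?thesis by (simp only: sum_pauli_if_bit)
qed

lemma mat_mult_entry:
  assumes "A \<in> carrier_mat n n" "B \<in> carrier_mat n n" "i < n" "j < n"
  shows "(A * B) $$ (i, j) = (\<Sum>k<n. A $$ (i, k) * B $$ (k, j))"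
  using assms by (simp add: scalar_prod_def atLeast0LessThan)

lemma row_supp_inverse:
  fixes s :: "nat \<Rightarrow> pauli"
  assumes R: "R \<in> carrier_mat n n" "R' \<in> carrier_mat n n" "R' * R = 1\<^sub>m n" and k: "k < n"
  shows "s k = (\<Sum>i\<in>row_supp n R' k. \<Sum>j\<in>row_supp n R i. s j)"
proof -
  have "(\<Sum>i\<in>row_supp n R' k. \<Sum>j\<in>row_supp n R i. s j)
     = (\<Sum>i<n. if R' $$ (k, i) = 1 then \<Sum>j\<in>row_supp n R i. s j else 0)"
    by (rule sum_row_supp)
  also have "\<dots> = (\<Sum>j<n. if (\<Sum>i<n. R' $$ (k, i) * R $$ (i, j)) = 1 then s j else 0)"
    by (rule sum_row_supp_combination)
  also have "\<dots> = (\<Sum>j<n. if k = j then s j else 0)"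
  proof (rule sum.cong[OF refl])
    fix j assume "j \<in> {..<n}"
    then have "(\<Sum>i<n. R' $$ (k, i) * R $$ (i, j)) = (if k = j then 1 else 0)"
      using mat_mult_entry[OF R(2,1) k, of j] R(3) k by simp
    then show "(if (\<Sum>i<n. R' $$ (k, i) * R $$ (i, j)) = 1 then s j else 0) = (if k = j then s j else 0)"
      by simp
  qed
  also have "\<dots> = s k" using k by simp
  finally show ?thesis by simp
qed

text \<open>A product of the generators with coefficient row \<open>t\<close> is the product of the
  new ones with coefficient row \<open>u = t R'\<close>, because \<open>u R = t\<close>; in
  particular \<open>u\<close> is nonzero when \<open>t\<close> is.\<close>

lemma independent_row_supp:
  assumes R: "R \<in> carrier_mat n n" "R' \<in> carrier_mat n n" "R' * R = 1\<^sub>m n"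
    and ind: "\<And>T. T \<subseteq> {..<n} \<Longrightarrow> T \<noteq> {} \<Longrightarrow> \<exists>\<mu>\<in>Q. (\<Sum>i\<in>T. \<Sum>j\<in>row_supp n R i. s j \<mu>) \<noteq> (0 :: pauli)"
    and T: "T \<subseteq> {..<n}" "T \<noteq> {}"
  shows "\<exists>\<mu>\<in>Q. (\<Sum>j\<in>T. s j \<mu>) \<noteq> 0"
proof -
  define t where "t j = (if j \<in> T then 1 else 0 :: bit)" for j
  define u where "u i = (\<Sum>k<n. t k * R' $$ (k, i))" for i
  have uR: "(\<Sum>i<n. u i * R $$ (i, j)) = t j" if "j < n" for j
  proof -
    have "(\<Sum>i<n. u i * R $$ (i, j)) = (\<Sum>i<n. \<Sum>k<n. t k * (R' $$ (k, i) * R $$ (i, j)))"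
      unfolding u_def by (simp only: sum_distrib_right mult.assoc)
    also have "\<dots> = (\<Sum>k<n. \<Sum>i<n. t k * (R' $$ (k, i) * R $$ (i, j)))" by (rule sum.swap)
    also have "\<dots> = (\<Sum>k<n. t k * (R' * R) $$ (k, j))"
      by (intro sum.cong refl) (simp only: mat_mult_entry[OF R(2,1) _ that] lessThan_iff sum_distrib_left)
    also have "\<dots> = (\<Sum>k<n. if k = j then t j else 0)"
      by (rule sum.cong) (use R(3) that in auto)
    also have "\<dots> = t j" using that by simp
    finally show ?thesis .
  qed
  define T' where "T' = {i \<in> {..<n}. u i = 1}"
  have "T' \<noteq> {}"
  proof
    assume "T' = {}"
    then have "u i = 0" if "i < n" for i using that by (auto simp: T'_def)
    then have "t j = 0" if "j < n" for j using uR[OF that] by simp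
    moreover obtain x where "x \<in> T" "x < n" using T by auto
    ultimately show False using t_def[of x] by simp
  qed
  then obtain \<mu> where \<mu>: "\<mu> \<in> Q" "(\<Sum>i\<in>T'. \<Sum>j\<in>row_supp n R i. s j \<mu>) \<noteq> 0"
    using ind[of T'] by (auto simp: T'_def)
  have "(\<Sum>i\<in>T'. \<Sum>j\<in>row_supp n R i. s j \<mu>) = (\<Sum>i<n. if u i = 1 then \<Sum>j\<in>row_supp n R i. s j \<mu> else 0)"
    unfolding T'_def by (rule sum.inter_filter) simp
  also have "\<dots> = (\<Sum>j<n. if (\<Sum>i<n. u i * R $$ (i, j)) = 1 then s j \<mu> else 0)"
    by (rule sum_row_supp_combination)
  also have "\<dots> = (\<Sum>j<n. if j \<in> T then s j \<mu> else 0)"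
  proof (rule sum.cong[OF refl])
    fix j assume "j \<in> {..<n}"
    then have "(\<Sum>i<n. u i * R $$ (i, j)) = t j" by (intro uR) simp
    then show "(if (\<Sum>i<n. u i * R $$ (i, j)) = 1 then s j \<mu> else 0) = (if j \<in> T then s j \<mu> else 0)"
      by (simp only: t_def) simp
  qed
  also have "\<dots> = (\<Sum>j\<in>T. s j \<mu>)"
    using T(1) by (simp add: sum.If_cases Int_absorb1)
  finally show ?thesis using \<mu> by auto
qed

text \<open>At one qubit two rows anticommute only if one contributes \<open>q\<close> and the other
  \<open>l\<close>, that is, at an endpoint of an edge joining \<open>a\<close> and
  \<open>b\<close>. Keeping \<open>q\<close> and \<open>l\<close> general covers the rows before and
  after they become X and Z.\<close>

lemma sympl_graph_rows:
  assumes "\<And>u v. E u v \<Longrightarrow> E v u \<and> u \<noteq> v" "\<And>a. sympl (q a) (l a) = 1"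
    "p = (if \<mu> = a then q a else if E a \<mu> then l \<mu> else 0)"
    "p' = (if \<mu> = b then q b else if E b \<mu> then l \<mu> else 0)"
  shows "sympl p p' = (if E a b \<and> (\<mu> = a \<or> \<mu> = b) then 1 else 0)"
  using assms(2)[of a] assms(2)[of b] assms(1) unfolding assms(3,4)
  by (auto simp: sympl_commute)

lemma graph_form_exists:
  assumes sub: "\<Omega> \<subseteq> {..<N}" and card: "card \<Omega> = n"
    and ind: "\<And>T. T \<subseteq> {..<n} \<Longrightarrow> T \<noteq> {} \<Longrightarrow> \<exists>\<mu>\<in>\<Omega>. (\<Sum>j\<in>T. s j \<mu>) \<noteq> 0"
    and comm: "\<And>i j. i < n \<Longrightarrow> j < n \<Longrightarrow> (\<Sum>\<mu>\<in>\<Omega>. sympl (s i \<mu>) (s j \<mu>)) = 0"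
    and out: "\<And>i j \<eta>. i < n \<Longrightarrow> j < n \<Longrightarrow> \<eta> < N \<Longrightarrow> \<eta> \<notin> \<Omega> \<Longrightarrow> sympl (s i \<eta>) (s j \<eta>) = 0"
  obtains R f E q l where "R \<in> carrier_mat n n" "invertible_mat R" "bij_betw f {..<n} \<Omega>" "simple_graph N E"
    "\<And>\<mu>. sympl (q \<mu>) (l \<mu>) = 1"
    "\<And>i \<mu>. i < n \<Longrightarrow> \<mu> < N \<Longrightarrow> (\<Sum>j\<in>row_supp n R i. s j \<mu>)
       = (if \<mu> = f i then q (f i) else if E (f i) \<mu> then l \<mu> else 0)"
proof -
  have fin: "finite \<Omega>" using sub finite_subset by auto
  obtain f where f: "bij_betw f {..<n} \<Omega>"
    using ex_bij_betw_nat_finite[OF fin] card by (auto simp: atLeast0LessThan)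
  have f\<Omega>: "f i \<in> \<Omega>" "f i < N" if "i < n" for i using that f sub by (auto simp: bij_betw_def)
  have f_inj: "f i = f j \<longleftrightarrow> i = j" if "i < n" "j < n" for i j
    using f that by (auto simp: bij_betw_def inj_on_def)
  have f_surj: "\<exists>i<n. \<mu> = f i" if "\<mu> \<in> \<Omega>" for \<mu> using that f by (auto simp: bij_betw_def)
  obtain l0 where l0: "\<forall>\<mu>. l0 \<mu> \<noteq> 0"
    "\<forall>T. T \<subseteq> {..<n} \<and> T \<noteq> {} \<longrightarrow> (\<exists>\<mu>\<in>\<Omega>. sympl (l0 \<mu>) (\<Sum>j\<in>T. s j \<mu>) \<noteq> 0)"
  proof -
    have "\<exists>l. (\<forall>\<mu>. l \<mu> \<noteq> 0) \<and>
      (\<forall>T. T \<subseteq> {..<n} \<and> T \<noteq> {} \<longrightarrow> (\<exists>\<mu>\<in>\<Omega>. sympl (l \<mu>) (\<Sum>j\<in>T. s j \<mu>) \<noteq> 0))"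
      by (rule transversal_lines) (fact fin, rule ind, assumption+, rule comm, assumption+)
    then show ?thesis using that by (elim exE conjE)
  qed
  \<comment> \<open>Entry \<open>(i, j)\<close> tells whether generator \<open>i\<close> leaves the
    chosen line at qubit \<open>f j\<close>.\<close>
  define A where "A = mat n n (\<lambda>(i, j). sympl (l0 (f j)) (s i (f j)))"
  have A: "A \<in> carrier_mat n n" by (simp add: A_def)
  have "\<exists>j<n. (\<Sum>i\<in>T. A $$ (i, j)) \<noteq> 0" if T: "T \<subseteq> {..<n}" "T \<noteq> {}" for T
  proof -
    obtain \<mu> where \<mu>: "\<mu> \<in> \<Omega>" "sympl (l0 \<mu>) (\<Sum>j\<in>T. s j \<mu>) \<noteq> 0" using l0(2) T by blast
    obtain j where j: "j < n" "\<mu> = f j" using f_surj \<mu>(1) by blast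
    have "(\<Sum>i\<in>T. A $$ (i, j)) = (\<Sum>i\<in>T. sympl (l0 \<mu>) (s i \<mu>))"
      by (rule sum.cong) (use T j in \<open>auto simp: A_def\<close>)
    then show ?thesis using \<mu>(2) j unfolding sympl_sum_right by auto
  qed
  then obtain R where R: "R \<in> carrier_mat n n" "invertible_mat R" "R * A = 1\<^sub>m n"
    using bit_mat_left_inverse[OF A] by blast
  define P where "P i \<mu> = (\<Sum>j\<in>row_supp n R i. s j \<mu>)" for i \<mu>
  \<comment> \<open>Outside \<Omega> the generators commute at each qubit, so their nontrivial
    factors there coincide and give the line; \<open>PX\<close> is a default where all factors are
    trivial.\<close>
  define l where "l \<mu> = (if \<mu> \<in> \<Omega> then l0 \<mu> else if \<exists>j<n. s j \<mu> \<noteq> 0 then s (SOME j. j < n \<and> s j \<mu> \<noteq> 0) \<mu> else PX)" for \<mu>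
  have some: "(SOME j. j < n \<and> s j \<mu> \<noteq> 0) < n \<and> s (SOME j. j < n \<and> s j \<mu> \<noteq> 0) \<mu> \<noteq> 0" if "\<exists>j<n. s j \<mu> \<noteq> 0" for \<mu>
    using that by (rule someI_ex)
  have l: "l \<mu> \<noteq> 0" for \<mu>
    using l0(1) some[of \<mu>] by (auto simp: l_def) (simp add: zero_pauli_def)
  have lP: "sympl (l \<mu>) (P i \<mu>) = (if \<mu> = f i then 1 else 0)" if i: "i < n" and \<mu>: "\<mu> < N" for i \<mu>
  proof (cases "\<mu> \<in> \<Omega>")
    case True
    then obtain j where j: "j < n" "\<mu> = f j" using f_surj by blast
    have "sympl (l \<mu>) (P i \<mu>) = (\<Sum>k\<in>row_supp n R i. sympl (l0 \<mu>) (s k \<mu>))"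
      using True by (simp add: P_def sympl_sum_right l_def)
    also have "\<dots> = (\<Sum>k\<in>row_supp n R i. A $$ (k, j))"
      by (rule sum.cong) (use j in \<open>auto simp: A_def row_supp_def\<close>)
    also have "row_supp n R i = {k \<in> {..<n}. R $$ (i, k) = 1}" by (auto simp: row_supp_def)
    also have "(\<Sum>k\<in>{k \<in> {..<n}. R $$ (i, k) = 1}. A $$ (k, j)) = (\<Sum>k<n. R $$ (i, k) * A $$ (k, j))"
      by (rule sum_bit_mult[symmetric]) simp
    also have "\<dots> = (R * A) $$ (i, j)" using mat_mult_entry[OF R(1) A i j(1)] by simp
    also have "\<dots> = (if \<mu> = f i then 1 else 0)" using R(3) i j f_inj by auto
    finally show ?thesis .
  next
    case False
    have "sympl (l \<mu>) (s k \<mu>) = 0" if "k < n" for k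
    proof (cases "\<exists>j<n. s j \<mu> \<noteq> 0")
      case True
      then show ?thesis using some[OF True] out[OF _ that \<mu> False] False by (simp add: l_def)
    next
      case False
      then show ?thesis using that by simp
    qed
    then have "sympl (l \<mu>) (P i \<mu>) = 0"
      unfolding P_def sympl_sum_right by (intro sum.neutral) (auto simp: row_supp_def)
    then show ?thesis using False f\<Omega>[OF i] by auto
  qed
  have P_cases: "P i \<mu> = 0 \<or> P i \<mu> = l \<mu>" if "i < n" "\<mu> < N" "\<mu> \<noteq> f i" for i \<mu>
    using lP[OF that(1,2)] that(3) l[of \<mu>] by (auto simp: sympl_eq_0_iff)
  \<comment> \<open>Products \<open>i\<close> and \<open>j\<close> commute on \<Omega>, and off
    \<open>f i\<close> and \<open>f j\<close> both stay in the line. The two remaining terms are the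
    two adjacency entries, which must therefore agree.\<close>
  have P_sym: "P i (f j) = 0 \<longleftrightarrow> P j (f i) = 0" if ij: "i < n" "j < n" "i \<noteq> j" for i j
  proof -
    have ne: "f i \<noteq> f j" using ij f_inj by auto
    have "0 = (\<Sum>\<mu>\<in>\<Omega>. sympl (P i \<mu>) (P j \<mu>))"
      unfolding P_def
      by (rule sum_sympl_sums_eq_0[where s = s, symmetric]) (use comm in \<open>auto simp: row_supp_def\<close>)
    also have "\<dots> = (\<Sum>\<mu>\<in>{f i, f j}. sympl (P i \<mu>) (P j \<mu>))"
    proof (rule sum.mono_neutral_right[OF fin])
      show "\<forall>\<mu>\<in>\<Omega> - {f i, f j}. sympl (P i \<mu>) (P j \<mu>) = 0"
      proof
        fix \<mu> assume \<mu>: "\<mu> \<in> \<Omega> - {f i, f j}"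
        then have "\<mu> < N" using sub by auto
        then have "sympl (l \<mu>) (P i \<mu>) = 0" "sympl (l \<mu>) (P j \<mu>) = 0"
          using lP[OF ij(1)] lP[OF ij(2)] \<mu> by auto
        then show "sympl (P i \<mu>) (P j \<mu>) = 0" using l by (rule sympl_same_line)
      qed
    qed (use f\<Omega> ij in auto)
    also have "\<dots> = sympl (P i (f i)) (P j (f i)) + sympl (P i (f j)) (P j (f j))"
      using ne by simp
    finally have e: "sympl (P i (f i)) (P j (f i)) + sympl (P i (f j)) (P j (f j)) = 0" by simp
    have "sympl (P i (f i)) (P j (f i)) = (if P j (f i) = 0 then 0 else 1)"
      using P_cases[of j "f i"] lP[of i "f i"] f\<Omega>[OF ij(1)] ij ne by (auto simp: sympl_commute)
    moreover have "sympl (P i (f j)) (P j (f j)) = (if P i (f j) = 0 then 0 else 1)"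
      using P_cases[of i "f j"] lP[of j "f j"] f\<Omega>[OF ij(2)] ij ne by auto
    ultimately show ?thesis using e by (auto split: if_splits)
  qed
  \<comment> \<open>Edges leaving \<Omega> are visible only in the product of their inner end, so
    the relation is symmetrised; inside \<Omega> this adds nothing by \<open>P_sym\<close>.\<close>
  define E where "E u v \<longleftrightarrow> u < N \<and> v < N \<and> u \<noteq> v \<and>
     ((\<exists>i<n. u = f i \<and> P i v \<noteq> 0) \<or> (\<exists>i<n. v = f i \<and> P i u \<noteq> 0))" for u v
  have E: "simple_graph N E" by (auto simp: simple_graph_def E_def)
  have E_iff: "E (f i) \<mu> \<longleftrightarrow> P i \<mu> \<noteq> 0" if "i < n" "\<mu> < N" "\<mu> \<noteq> f i" for i \<mu>
    using that f\<Omega>[OF that(1)] f_inj P_sym by (auto simp: E_def)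
  \<comment> \<open>Outside \<Omega> no product contains \<open>q\<close>; any Pauli anticommuting
    with \<open>l\<close> allows a local Clifford to be chosen there too.\<close>
  define q where "q \<mu> = (if \<mu> \<in> \<Omega> then P (inv_into {..<n} f \<mu>) \<mu> else SOME a. a \<noteq> 0 \<and> a \<noteq> l \<mu>)" for \<mu>
  have qf: "q (f i) = P i (f i)" if "i < n" for i
    using that f f\<Omega> by (simp add: q_def bij_betw_def inv_into_f_f)
  have ql: "sympl (q \<mu>) (l \<mu>) = 1" for \<mu>
  proof (cases "\<mu> \<in> \<Omega>")
    case True
    then obtain i where "i < n" "\<mu> = f i" using f_surj by blast
    then show ?thesis using qf lP[of i \<mu>] f\<Omega> by (simp add: sympl_commute)
  next
    case False
    then have "q \<mu> \<noteq> 0 \<and> q \<mu> \<noteq> l \<mu>"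
      using someI_ex[OF pauli_avoid[of "l \<mu>"]] by (simp add: q_def)
    then show ?thesis using l by (simp add: sympl_def)
  qed
  show ?thesis
  proof (rule that[OF R(1,2) f E ql])
    fix i \<mu> assume "i < n" "\<mu> < N"
    then show "(\<Sum>j\<in>row_supp n R i. s j \<mu>) = (if \<mu> = f i then q (f i) else if E (f i) \<mu> then l \<mu> else 0)"
      using E_iff P_cases qf unfolding P_def[symmetric] by auto
  qed
qed

section \<open>Stabilizer groups\<close>

text \<open>The scalar is one of the four phases because the presentation of a nonzero Pauli
  operator is unique. With \<open>\<i>\<close> or \<open>-\<i>\<close> the operator would square to
  minus the identity.\<close>

lemma psem_in_stabilizer_sign:
  assumes S: "stabilizer_group N S" and A: "psem {..<N} c p \<in> S"
  shows "c \<in> {1, -1}"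
proof -
  let ?Q = "{..<N}"
  have "is_pauli_op N (psem ?Q c p)" using S A by (simp add: stabilizer_group_def)
  then obtain c' p' where c': "c' \<in> {1, -1, \<i>, -\<i>}" "psem ?Q c p = psem ?Q c' p'"
    unfolding is_pauli_op_def by blast
  have "p \<mu> = p' \<mu>" if "\<mu> \<in> ?Q" for \<mu>
    using psem_eqD[OF _ c'(2) _ that] c'(1) by fastforce
  then have "psem ?Q c' p' = psem ?Q c' p" by (intro psem_cong) auto
  then have "c = c'" using psem_eq_scalar[of ?Q c p c'] c' by simp
  moreover have "psem ?Q (c * c) (\<lambda>_. 0) \<in> S"
  proof -
    have "opmul ?Q (psem ?Q c p) (psem ?Q c p) \<in> S" using S A by (auto simp: stabilizer_group_def)
    then show ?thesis by (simp add: psem_mult phase_def)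
  qed
  moreover have "psem ?Q (-1) (\<lambda>_. 0) \<notin> S"
    using S by (simp add: stabilizer_group_def opid_psem opscale_psem)
  ultimately show ?thesis using c'(1) by auto
qed

lemma opprod_in_stabilizer:
  assumes S: "stabilizer_group N S" and A: "\<And>j. j < n \<Longrightarrow> Ops j \<in> S"
  shows "opprod {..<N} n Ops T \<in> S"
proof -
  have "foldr (\<lambda>j acc. if j \<in> T then opmul {..<N} (Ops j) acc else acc) xs (opid {..<N}) \<in> S"
    if "set xs \<subseteq> {..<n}" for xs
    using that by (induction xs) (use S A in \<open>auto simp: stabilizer_group_def\<close>)
  from this[of "[0..<n]"] show ?thesis by (simp add: opprod_def atLeast0LessThan)
qed

lemma inj_on_graph_gen:
  assumes "\<Omega> \<subseteq> {..<N}" shows "inj_on (graph_gen N E) \<Omega>"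
proof (rule inj_onI)
  fix u v assume "u \<in> \<Omega>" "v \<in> \<Omega>" and e: "graph_gen N E u = graph_gen N E v"
  then have "u \<in> {..<N}" using assms by auto
  from psem_eqD[OF _ e[unfolded graph_gen_def] _ this] show "u = v"
    by (auto split: if_splits)
qed

lemma invertible_bit_mat:
  assumes "R \<in> carrier_mat n n" "invertible_mat R"
  obtains R' where "R' \<in> carrier_mat n n" "R' * R = 1\<^sub>m n"
proof -
  obtain B where B: "R * B = 1\<^sub>m n" "B * R = 1\<^sub>m (dim_row B)"
    using assms by (auto simp: invertible_mat_def inverts_mat_def)
  have "dim_col B = n" using arg_cong[OF B(1), of dim_col] by simp
  moreover have "dim_row B = n" using arg_cong[OF B(2), of dim_col] assms(1) by simp
  ultimately show ?thesis using that[of B] B(2) by auto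
qed

text \<open>Changing the generators by an invertible binary matrix acts on the columns by invertible
  column operations.\<close>
lemma rank_pseudo_incidence_graph_form:
  assumes R: "R \<in> carrier_mat n n" "invertible_mat R"
    and f: "bij_betw f {..<n} \<Omega>" and sub: "\<Omega> \<subseteq> {..<N}" and ne: "\<Omega> \<noteq> {}" and E: "simple_graph N E"
    and p: "\<And>i j \<mu>. i < n \<Longrightarrow> j < n \<Longrightarrow> \<mu> < N \<Longrightarrow>
      sympl (\<Sum>k\<in>row_supp n R i. s k \<mu>) (\<Sum>k\<in>row_supp n R j. s k \<mu>)
        = (if E (f i) (f j) \<and> (\<mu> = f i \<or> \<mu> = f j) then 1 else 0)"
  shows "rank_F2 N (pseudo_incidence N n s) = n - 1 \<longleftrightarrow> induced_connected E \<Omega>"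
proof -
  obtain R' where R': "R' \<in> carrier_mat n n" "R' * R = 1\<^sub>m n"
    using invertible_bit_mat[OF R] .
  define P where "P i \<mu> = (\<Sum>k\<in>row_supp n R i. s k \<mu>)" for i \<mu>
  have "rank_F2 N (pseudo_incidence N n P) = rank_F2 N (pseudo_incidence N n s)"
  proof (rule rank_F2_cong_span[where T = "row_supp n R" and T' = "row_supp n R'"])
    show "s i \<mu> = (\<Sum>k\<in>row_supp n R' i. P k \<mu>)" if "i < n" for i \<mu>
      unfolding P_def using row_supp_inverse[OF R(1) R' that, of "\<lambda>k. s k \<mu>"] .
  qed (simp_all add: P_def row_supp_subset)
  moreover have "rank_F2 N (pseudo_incidence N n P) = n - 1 \<longleftrightarrow> induced_connected E \<Omega>"
    by (rule rank_F2_graph[OF f sub ne]) (use E p in \<open>auto simp: P_def simple_graph_def\<close>)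
  ultimately show ?thesis by simp
qed

text \<open>The unitary at \<open>f i\<close> sends \<open>q\<close> to X times the sign of product
  \<open>i\<close>. This cancels that sign and disturbs no other product, since the others have only
  \<open>l\<close> or the identity at \<open>f i\<close>.\<close>

lemma graph_form_imp_local_equivalent:
  assumes S: "stabilizer_group N S" and in_S: "\<forall>i<n. psem {..<N} (c i) (sp i) \<in> S"
    and sub: "\<Omega> \<subseteq> {..<N}" and f: "bij_betw f {..<n} \<Omega>"
    and ql: "\<And>\<mu>. sympl (q \<mu>) (l \<mu>) = 1"
    and form: "\<And>i \<mu>. i < n \<Longrightarrow> \<mu> < N \<Longrightarrow> (\<Sum>j\<in>row_supp n R i. sp j \<mu>)
       = (if \<mu> = f i then q (f i) else if E (f i) \<mu> then l \<mu> else 0)"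
  obtains U where "local_unitary N U"
    "\<And>i. i < n \<Longrightarrow> conj_by N U (opprod {..<N} n (\<lambda>j. psem {..<N} (c j) (sp j)) (row_supp n R i)) = graph_gen N E (f i)"
proof -
  let ?Q = "{..<N}"
  define P where "P i \<mu> = (\<Sum>j\<in>row_supp n R i. sp j \<mu>)" for i \<mu>
  let ?W = "\<lambda>i. opprod ?Q n (\<lambda>j. psem ?Q (c j) (sp j)) (row_supp n R i)"
  have c: "c j \<noteq> 0" if "j < n" for j
    using psem_in_stabilizer_sign[OF S in_S[rule_format, OF that]] by auto
  have "\<exists>d. \<forall>i. d i \<in> {1, -1} \<and> ?W i = psem ?Q (d i) (P i)"
  proof (intro choice allI)
    fix i
    have "row_supp n R i \<inter> {..<n} = row_supp n R i" by (auto simp: row_supp_def)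
    then obtain d where d: "?W i = psem ?Q d (P i)"
      using opprod_psem[of ?Q n c sp "row_supp n R i"] c unfolding P_def by auto
    have "?W i \<in> S" by (rule opprod_in_stabilizer[OF S]) (use in_S in blast)
    then have "d \<in> {1, -1}" unfolding d by (rule psem_in_stabilizer_sign[OF S])
    then show "\<exists>d. d \<in> {1, -1} \<and> ?W i = psem ?Q d (P i)" using d by blast
  qed
  then obtain d where d: "d i \<in> {1, -1}" "?W i = psem ?Q (d i) (P i)" for i by blast
  \<comment> \<open>Outside \<Omega> the inverse image is an arbitrary index; \<open>d\<close> is a
    sign at every index, so \<open>s\<close> is a sign everywhere.\<close>
  define s where "s \<mu> = d (inv_into {..<n} f \<mu>)" for \<mu>
  have sf: "s (f i) = d i" if "i < n" for i
    using that f by (simp add: s_def bij_betw_def inv_into_f_f)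
  have "\<exists>U. \<forall>\<mu>. unitary1 (U \<mu>) \<and> conj1 (U \<mu>) (pmat (q \<mu>)) = (\<lambda>x y. s \<mu> * pmat PX x y)
      \<and> conj1 (U \<mu>) (pmat (l \<mu>)) = pmat PZ"
  proof (intro choice allI)
    fix \<mu>
    have "q \<mu> \<noteq> 0" "l \<mu> \<noteq> 0" "q \<mu> \<noteq> l \<mu>" using ql[of \<mu>] by (auto simp: sympl_def split: if_splits)
    moreover have "s \<mu> \<in> {1, -1}" unfolding s_def by (rule d(1))
    ultimately show "\<exists>U. unitary1 U \<and> conj1 U (pmat (q \<mu>)) = (\<lambda>x y. s \<mu> * pmat PX x y)
      \<and> conj1 U (pmat (l \<mu>)) = pmat PZ"
      unfolding conj1_def by (rule clifford_exists)
  qed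
  then obtain U where U: "unitary1 (U \<mu>)" "conj1 (U \<mu>) (pmat (q \<mu>)) = (\<lambda>x y. s \<mu> * pmat PX x y)"
    "conj1 (U \<mu>) (pmat (l \<mu>)) = pmat PZ" for \<mu> by blast
  have U0: "conj1 (U \<mu>) (pmat 0) = pmat PI" for \<mu>
    using U(1)[of \<mu>] by (simp add: conj1_def unitary1_def zero_pauli_def)
  have "conj_by N U (?W i) = graph_gen N E (f i)" if i: "i < n" for i
  proof -
    have fi: "f i < N" using f sub i by (auto simp: bij_betw_def)
    define k where "k \<mu> = (if \<mu> = f i then d i else 1)" for \<mu>
    define g where "g \<mu> = (if \<mu> = f i then PX else if E (f i) \<mu> then PZ else PI)" for \<mu>
    have "conj_by N U (?W i) = opscale (d i) (tens ?Q (\<lambda>\<mu>. conj1 (U \<mu>) (pmat (P i \<mu>))))"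
      unfolding d(2) conj_by_psem conj1_def ..
    also have "tens ?Q (\<lambda>\<mu>. conj1 (U \<mu>) (pmat (P i \<mu>))) = tens ?Q (\<lambda>\<mu> x y. k \<mu> * pmat (g \<mu>) x y)"
    proof (rule tens_cong)
      fix \<mu> assume "\<mu> \<in> ?Q"
      then show "conj1 (U \<mu>) (pmat (P i \<mu>)) = (\<lambda>x y. k \<mu> * pmat (g \<mu>) x y)"
        using form[OF i, of \<mu>] U(2)[of "f i"] U(3)[of \<mu>] U0[of \<mu>] sf[OF i]
        by (auto simp: P_def k_def g_def)
    qed
    also have "\<dots> = opscale (d i) (tens ?Q (\<lambda>\<mu>. pmat (g \<mu>)))"
      using fi by (simp add: tens_scale k_def)
    also have "opscale (d i) \<dots> = graph_gen N E (f i)"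
      using d(1)[of i] by (auto simp: graph_gen_def psem_def g_def)
    finally show ?thesis .
  qed
  moreover have "local_unitary N U" using U(1) by (simp add: local_unitary_def)
  ultimately show ?thesis using that by blast
qed

text \<open>The set equality determines which vertex each product goes to, since distinct vertices
  have distinct generators. Comparing tensor factors then transfers triviality and commutation at
  each qubit, with all scalars discarded.\<close>

lemma local_equivalent_imp_graph_commutation:
  assumes c: "\<And>j. j < n \<Longrightarrow> c j \<noteq> 0" and U: "local_unitary N U"
    and sub: "\<Omega> \<subseteq> {..<N}" and card: "card \<Omega> = n"
    and eq: "(\<lambda>i. conj_by N U (opprod {..<N} n (\<lambda>j. psem {..<N} (c j) (sp j)) (row_supp n R i))) ` {..<n}
              = graph_gen N E ` \<Omega>"
  obtains f where "bij_betw f {..<n} \<Omega>"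
    "\<And>i \<mu>. i < n \<Longrightarrow> \<mu> < N \<Longrightarrow> (\<Sum>j\<in>row_supp n R i. sp j \<mu>) = 0 \<longleftrightarrow> \<mu> \<noteq> f i \<and> \<not> E (f i) \<mu>"
    "\<And>i j \<mu>. i < n \<Longrightarrow> j < n \<Longrightarrow> \<mu> < N \<Longrightarrow>
      sympl (\<Sum>k\<in>row_supp n R i. sp k \<mu>) (\<Sum>k\<in>row_supp n R j. sp k \<mu>)
        = sympl (if \<mu> = f i then PX else if E (f i) \<mu> then PZ else PI)
            (if \<mu> = f j then PX else if E (f j) \<mu> then PZ else PI)"
proof -
  let ?Q = "{..<N}"
  let ?V = "\<lambda>i. conj_by N U (opprod ?Q n (\<lambda>j. psem ?Q (c j) (sp j)) (row_supp n R i))"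
  define P where "P i \<mu> = (\<Sum>j\<in>row_supp n R i. sp j \<mu>)" for i \<mu>
  define f where "f i = inv_into \<Omega> (graph_gen N E) (?V i)" for i
  define g where "g i \<mu> = (if \<mu> = f i then PX else if E (f i) \<mu> then PZ else PI)" for i \<mu>
  have fV: "?V i = graph_gen N E (f i)" "f i \<in> \<Omega>" if "i < n" for i
  proof -
    have "?V i \<in> graph_gen N E ` \<Omega>" using that eq by auto
    then show "?V i = graph_gen N E (f i)" "f i \<in> \<Omega>"
      unfolding f_def by (simp_all only: f_inv_into_f inv_into_into)
  qed
  have "f ` {..<n} = \<Omega>"
  proof
    show "\<Omega> \<subseteq> f ` {..<n}"
    proof
      fix \<mu> assume \<mu>: "\<mu> \<in> \<Omega>"
      then have "graph_gen N E \<mu> \<in> ?V ` {..<n}" unfolding eq by (rule imageI)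
      then obtain i where i: "i < n" "?V i = graph_gen N E \<mu>" by auto
      then have "f i = \<mu>" using fV[OF i(1)] \<mu> inj_on_graph_gen[OF sub] by (auto dest: inj_onD)
      then show "\<mu> \<in> f ` {..<n}" using i by auto
    qed
  qed (use fV in auto)
  \<comment> \<open>A surjection between sets of equal finite size is injective.\<close>
  then have f: "bij_betw f {..<n} \<Omega>"
    using card by (auto simp: bij_betw_def intro: eq_card_imp_inj_on)
  have loc: "unitary1 (U \<mu>) \<and> (\<exists>k. k \<noteq> 0 \<and> conj1 (U \<mu>) (pmat (P i \<mu>)) = (\<lambda>x y. k * pmat (g i \<mu>) x y))"
    if i: "i < n" and \<mu>: "\<mu> < N" for i \<mu>
  proof
    have u: "unitary1 (U \<nu>)" if "\<nu> \<in> ?Q" for \<nu> using U that by (simp add: local_unitary_def)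
    then show "unitary1 (U \<mu>)" using \<mu> by simp
    have "row_supp n R i \<inter> {..<n} = row_supp n R i" by (auto simp: row_supp_def)
    then obtain d where d: "d \<noteq> 0" "opprod ?Q n (\<lambda>j. psem ?Q (c j) (sp j)) (row_supp n R i) = psem ?Q d (P i)"
      using opprod_psem[of ?Q n c sp "row_supp n R i"] c unfolding P_def by auto
    have "opscale d (tens ?Q (\<lambda>\<mu>. conj1 (U \<mu>) (pmat (P i \<mu>)))) = opscale 1 (tens ?Q (\<lambda>\<mu>. pmat (g i \<mu>)))"
      using fV(1)[OF i, unfolded d(2) conj_by_psem, folded conj1_def]
      unfolding graph_gen_def psem_def g_def .
    from tens_factor[OF _ _ _ this] show "\<exists>k. k \<noteq> 0 \<and> conj1 (U \<mu>) (pmat (P i \<mu>)) = (\<lambda>x y. k * pmat (g i \<mu>) x y)"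
      using conj1_pmat_nonzero[OF u] pmat_nonzero \<mu> by simp
  qed
  show ?thesis
  proof (rule that[OF f], unfold P_def[symmetric] g_def[symmetric])
    fix i \<mu> assume "i < n" "\<mu> < N"
    then obtain k where "unitary1 (U \<mu>)" "k \<noteq> 0" "conj1 (U \<mu>) (pmat (P i \<mu>)) = (\<lambda>x y. k * pmat (g i \<mu>) x y)"
      using loc by blast
    then have "P i \<mu> = 0 \<longleftrightarrow> g i \<mu> = 0" using conj1_pmat_eq_0_iff by blast
    then show "P i \<mu> = 0 \<longleftrightarrow> \<mu> \<noteq> f i \<and> \<not> E (f i) \<mu>" by (simp add: g_def zero_pauli_def)
  next
    fix i j \<mu> assume ij: "i < n" "j < n" "\<mu> < N"
    obtain k where k: "unitary1 (U \<mu>)" "k \<noteq> 0" "conj1 (U \<mu>) (pmat (P i \<mu>)) = (\<lambda>x y. k * pmat (g i \<mu>) x y)"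
      using loc ij by blast
    obtain m where m: "m \<noteq> 0" "conj1 (U \<mu>) (pmat (P j \<mu>)) = (\<lambda>x y. m * pmat (g j \<mu>) x y)"
      using loc ij by blast
    show "sympl (P i \<mu>) (P j \<mu>) = sympl (g i \<mu>) (g j \<mu>)"
      by (rule conj1_pmat_sympl[OF k(1,3,2) m(2,1)])
  qed
qed

section \<open>Equivalence of connected local graph form with the independence, commutation and rank
  conditions\<close>

theorem theorem1:
  fixes N n :: nat and S :: "qop set" and \<Omega> :: "nat set"
    and c :: "nat \<Rightarrow> complex" and sp :: "nat \<Rightarrow> nat \<Rightarrow> pauli"
  assumes "N \<ge> 2"
    and "stabilizer_group N S"
    and "\<Omega> \<subseteq> {..<N}" and "\<Omega> \<noteq> {}" and "card \<Omega> = n" and "n < N"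
    and "\<forall>i<n. psem {..<N} (c i) (sp i) \<in> S"
    and "inj_on (\<lambda>i. psem {..<N} (c i) (sp i)) {..<n}"
  shows "(\<exists>U (R :: bit mat) E.
            local_unitary N U \<and> R \<in> carrier_mat n n \<and> invertible_mat R \<and> simple_graph N E
          \<and> (\<lambda>i. conj_by N U (opprod {..<N} n (\<lambda>j. psem {..<N} (c j) (sp j))
                                 {j. j < n \<and> R $$ (i, j) = 1})) ` {..<n}
              = graph_gen N E ` \<Omega>
          \<and> induced_connected E \<Omega>)
    \<longleftrightarrow>
         (independent_ops {..<N} n (\<lambda>i. psem {..<N} (c i) (sp i))
          \<and> mutually_commuting {..<N} n (\<lambda>i. psem {..<N} (c i) (sp i)))
       \<and> (independent_ops \<Omega> n (\<lambda>i. tens \<Omega> (\<lambda>\<mu>. pmat (sp i \<mu>)))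
          \<and> mutually_commuting \<Omega> n (\<lambda>i. tens \<Omega> (\<lambda>\<mu>. pmat (sp i \<mu>))))
       \<and> (\<forall>i<n. \<forall>j<n. i \<noteq> j \<longrightarrow> (\<forall>\<eta><N. \<eta> \<notin> \<Omega> \<longrightarrow> \<not> anticomm1 (sp i \<eta>) (sp j \<eta>)))
       \<and> rank_F2 N (pseudo_incidence N n sp) = n - 1"
    (is "?L \<longleftrightarrow> (?ind \<and> ?comm) \<and> (?ind\<Omega> \<and> ?comm\<Omega>) \<and> ?out \<and> ?rank")
proof -
  note S = assms(2) and sub = assms(3) and ne = assms(4) and card = assms(5) and in_S = assms(7)
  have fin: "finite \<Omega>" using sub finite_subset by auto
  have c: "c j \<noteq> 0" if "j < n" for j
    using psem_in_stabilizer_sign[OF S in_S[rule_format, OF that]] by auto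
  have tens: "tens \<Omega> (\<lambda>\<mu>. pmat (sp i \<mu>)) = psem \<Omega> 1 (sp i)" for i
    by (simp add: psem_def)
  have ind: "?ind \<longleftrightarrow> (\<forall>T. T \<subseteq> {..<n} \<and> T \<noteq> {} \<longrightarrow> (\<exists>\<mu>\<in>{..<N}. (\<Sum>j\<in>T. sp j \<mu>) \<noteq> 0))"
    using c by (intro independent_psem_iff) simp_all
  have ind\<Omega>: "?ind\<Omega> \<longleftrightarrow> (\<forall>T. T \<subseteq> {..<n} \<and> T \<noteq> {} \<longrightarrow> (\<exists>\<mu>\<in>\<Omega>. (\<Sum>j\<in>T. sp j \<mu>) \<noteq> 0))"
    unfolding tens using fin by (intro independent_psem_iff) simp_all
  have comm: ?comm
    using S in_S by (simp add: mutually_commuting_def stabilizer_group_def)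
  have comm\<Omega>: "?comm\<Omega> \<longleftrightarrow> (\<forall>i<n. \<forall>j<n. (\<Sum>\<mu>\<in>\<Omega>. sympl (sp i \<mu>) (sp j \<mu>)) = 0)"
    unfolding tens mutually_commuting_def using commute_psem_iff[OF fin] by simp
  have out: "?out \<longleftrightarrow> (\<forall>i<n. \<forall>j<n. \<forall>\<eta><N. \<eta> \<notin> \<Omega> \<longrightarrow> sympl (sp i \<eta>) (sp j \<eta>) = 0)"
    unfolding anticomm1_iff bit_not_one_iff
  proof (intro iffI allI impI)
    fix i j \<eta> assume *: "\<forall>i<n. \<forall>j<n. i \<noteq> j \<longrightarrow> (\<forall>\<eta><N. \<eta> \<notin> \<Omega> \<longrightarrow> sympl (sp i \<eta>) (sp j \<eta>) = 0)"
      "i < n" "j < n" "\<eta> < N" "\<eta> \<notin> \<Omega>"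
    then show "sympl (sp i \<eta>) (sp j \<eta>) = 0" by (cases "i = j") simp_all
  qed simp
  show ?thesis
  proof
    assume ?L
    then obtain U R E where U: "local_unitary N U" and R: "R \<in> carrier_mat n n" "invertible_mat R"
      and E: "simple_graph N E" and conn: "induced_connected E \<Omega>"
      and eq: "(\<lambda>i. conj_by N U (opprod {..<N} n (\<lambda>j. psem {..<N} (c j) (sp j)) (row_supp n R i))) ` {..<n}
              = graph_gen N E ` \<Omega>"
      unfolding row_supp_def by blast
    obtain R' where R': "R' \<in> carrier_mat n n" "R' * R = 1\<^sub>m n"
      using invertible_bit_mat[OF R] .
    define P where "P i \<mu> = (\<Sum>j\<in>row_supp n R i. sp j \<mu>)" for i \<mu>
    obtain f where f: "bij_betw f {..<n} \<Omega>"
      and P0: "\<And>i \<mu>. i < n \<Longrightarrow> \<mu> < N \<Longrightarrow> P i \<mu> = 0 \<longleftrightarrow> \<mu> \<noteq> f i \<and> \<not> E (f i) \<mu>"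
      and P_gen: "\<And>i j \<mu>. i < n \<Longrightarrow> j < n \<Longrightarrow> \<mu> < N \<Longrightarrow> sympl (P i \<mu>) (P j \<mu>)
        = sympl (if \<mu> = f i then PX else if E (f i) \<mu> then PZ else PI)
            (if \<mu> = f j then PX else if E (f j) \<mu> then PZ else PI)"
      by (rule local_equivalent_imp_graph_commutation[OF _ U sub card eq, folded P_def], erule c, rule that, assumption+)
    have f_lt: "f i < N" if "i < n" for i using f sub that by (auto simp: bij_betw_def)
    have f_inj: "f i = f j \<longleftrightarrow> i = j" if "i < n" "j < n" for i j
      using f that by (auto simp: bij_betw_def inj_on_def)
    have E_sym: "E v u \<and> u \<noteq> v" if "E u v" for u v using E that by (auto simp: simple_graph_def)
    have P: "sympl (P i \<mu>) (P j \<mu>) = (if E (f i) (f j) \<and> (\<mu> = f i \<or> \<mu> = f j) then 1 else 0)"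
      if "i < n" "j < n" "\<mu> < N" for i j \<mu>
      unfolding P_gen[OF that]
      by (rule sympl_graph_rows[where q = "\<lambda>_. PX" and l = "\<lambda>_. PZ", OF E_sym])
         (simp_all add: sympl_def zero_pauli_def)
    have sP: "sp k \<mu> = (\<Sum>i\<in>row_supp n R' k. P i \<mu>)" if "k < n" for k \<mu>
      unfolding P_def using row_supp_inverse[OF R(1) R' that, of "\<lambda>k. sp k \<mu>"] .
    \<comment> \<open>The product over \<open>T\<close> is nontrivial at the vertex
      \<open>f i\<close> of any \<open>i\<close> in \<open>T\<close>. Were it trivial, pairing it
      there with \<open>P k\<close> would leave only the edge between \<open>f k\<close> and
      \<open>f i\<close>, so no such edge exists; then only \<open>P i (f i)\<close> remains, which
      is nonzero.\<close>
    have indP: "\<exists>\<mu>\<in>\<Omega>. (\<Sum>i\<in>T. P i \<mu>) \<noteq> 0" if T: "T \<subseteq> {..<n}" "T \<noteq> {}" for T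
    proof -
      obtain i where i: "i \<in> T" "i < n" using T by auto
      have finT: "finite T" using T finite_subset by auto
      have "(\<Sum>k\<in>T. P k (f i)) \<noteq> 0"
      proof
        assume z: "(\<Sum>k\<in>T. P k (f i)) = 0"
        have "P k (f i) = 0" if k: "k \<in> T - {i}" for k
        proof -
          have kn: "k < n" "k \<noteq> i" using k T by auto
          have "0 = sympl (P k (f i)) (\<Sum>m\<in>T. P m (f i))" using z by simp
          also have "\<dots> = (\<Sum>m\<in>T. sympl (P k (f i)) (P m (f i)))" by (rule sympl_sum_right)
          also have "\<dots> = (\<Sum>m\<in>T. if m = i then (if E (f k) (f i) then 1 else 0) else 0)"
          proof (rule sum.cong[OF refl])
            fix m assume "m \<in> T"
            then show "sympl (P k (f i)) (P m (f i)) = (if m = i then (if E (f k) (f i) then 1 else 0) else 0)"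
              using P[OF kn(1) _ f_lt[OF i(2)], of m] T f_inj[OF i(2)] kn by auto
          qed
          also have "\<dots> = (if E (f k) (f i) then 1 else 0)"
            using i finT by simp
          finally have "\<not> E (f k) (f i)" by (auto split: if_splits)
          then show ?thesis using P0[OF kn(1) f_lt[OF i(2)]] f_inj[OF i(2) kn(1)] kn by simp
        qed
        then have "(\<Sum>k\<in>T. P k (f i)) = P i (f i)"
          using sum.remove[OF finT i(1), of "\<lambda>k. P k (f i)"] by simp
        then show False using z P0[OF i(2) f_lt[OF i(2)]] by simp
      qed
      moreover have "f i \<in> \<Omega>" using f i by (auto simp: bij_betw_def)
      ultimately show ?thesis by blast
    qed
    have i\<Omega>: "\<exists>\<mu>\<in>\<Omega>. (\<Sum>j\<in>T. sp j \<mu>) \<noteq> 0" if "T \<subseteq> {..<n}" "T \<noteq> {}" for T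
      by (rule independent_row_supp[OF R(1) R' _ that]) (use indP in \<open>simp add: P_def\<close>)
    have o: "sympl (sp i \<eta>) (sp j \<eta>) = 0" if "i < n" "j < n" "\<eta> < N" "\<eta> \<notin> \<Omega>" for i j \<eta>
    proof -
      have "\<eta> \<noteq> f k" if "k < n" for k using f that \<open>\<eta> \<notin> \<Omega>\<close> by (auto simp: bij_betw_def)
      then have "sympl (P k \<eta>) (P m \<eta>) = 0" if "k < n" "m < n" for k m
        using P[OF that \<open>\<eta> < N\<close>] that by simp
      then show ?thesis
        unfolding sP[OF that(1)] sP[OF that(2)] sympl_sum_left unfolding sympl_sum_right
        by (intro sum.neutral ballI) (simp add: row_supp_def)
    qed
    \<comment> \<open>The full operators commute and contribute nothing outside \<Omega>, so the
      parity on \<Omega> is even as well.\<close>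
    have "(\<Sum>\<mu>\<in>\<Omega>. sympl (sp i \<mu>) (sp j \<mu>)) = 0" if ij: "i < n" "j < n" for i j
    proof -
      have "(\<Sum>\<mu>\<in>\<Omega>. sympl (sp i \<mu>) (sp j \<mu>)) = (\<Sum>\<mu><N. sympl (sp i \<mu>) (sp j \<mu>))"
        by (rule sum.mono_neutral_left) (use sub o ij in auto)
      also have "\<dots> = 0"
      proof -
        have "commute_op {..<N} (psem {..<N} (c i) (sp i)) (psem {..<N} (c j) (sp j))"
          using comm ij unfolding mutually_commuting_def by blast
        then show ?thesis by (subst (asm) commute_psem_iff) (simp_all add: c ij)
      qed
      finally show ?thesis .
    qed
    then have ?comm\<Omega> unfolding comm\<Omega> by blast
    moreover have ?ind unfolding ind using i\<Omega> sub by blast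
    moreover have ?ind\<Omega> unfolding ind\<Omega> using i\<Omega> by blast
    moreover have ?out unfolding out using o by blast
    moreover have ?rank
      by (subst rank_pseudo_incidence_graph_form[OF R f sub ne E P[unfolded P_def]]) (assumption+, rule conn)
    ultimately show "(?ind \<and> ?comm) \<and> (?ind\<Omega> \<and> ?comm\<Omega>) \<and> ?out \<and> ?rank" using comm by blast
  next
    assume "(?ind \<and> ?comm) \<and> (?ind\<Omega> \<and> ?comm\<Omega>) \<and> ?out \<and> ?rank"
    then have "?ind\<Omega>" "?comm\<Omega>" "?out" "?rank" by blast+
    then have rhs: "\<And>T. T \<subseteq> {..<n} \<Longrightarrow> T \<noteq> {} \<Longrightarrow> \<exists>\<mu>\<in>\<Omega>. (\<Sum>j\<in>T. sp j \<mu>) \<noteq> 0"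
      "\<And>i j. i < n \<Longrightarrow> j < n \<Longrightarrow> (\<Sum>\<mu>\<in>\<Omega>. sympl (sp i \<mu>) (sp j \<mu>)) = 0"
      "\<And>i j \<eta>. i < n \<Longrightarrow> j < n \<Longrightarrow> \<eta> < N \<Longrightarrow> \<eta> \<notin> \<Omega> \<Longrightarrow> sympl (sp i \<eta>) (sp j \<eta>) = 0"
      unfolding ind\<Omega> comm\<Omega> out by simp_all
    obtain R f E q l where R: "R \<in> carrier_mat n n" "invertible_mat R"
      and f: "bij_betw f {..<n} \<Omega>" and E: "simple_graph N E"
      and ql: "\<And>\<mu>. sympl (q \<mu>) (l \<mu>) = 1"
      and form: "\<And>i \<mu>. i < n \<Longrightarrow> \<mu> < N \<Longrightarrow> (\<Sum>j\<in>row_supp n R i. sp j \<mu>)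
       = (if \<mu> = f i then q (f i) else if E (f i) \<mu> then l \<mu> else 0)"
      by (rule graph_form_exists[where s = sp, OF sub card],
          erule rhs, assumption, erule rhs, assumption, erule rhs, assumption+, rule that, assumption+)
    obtain U where U: "local_unitary N U" and
      conj: "\<And>i. i < n \<Longrightarrow> conj_by N U (opprod {..<N} n (\<lambda>j. psem {..<N} (c j) (sp j)) (row_supp n R i)) = graph_gen N E (f i)"
      by (rule graph_form_imp_local_equivalent[where E = E and R = R, OF S in_S sub f ql],
          rule form, assumption+, rule that, assumption+)
    have "(\<lambda>i. conj_by N U (opprod {..<N} n (\<lambda>j. psem {..<N} (c j) (sp j)) (row_supp n R i))) ` {..<n}
        = (\<lambda>i. graph_gen N E (f i)) ` {..<n}"
      by (rule image_cong[OF refl]) (simp add: conj)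
    also have "\<dots> = graph_gen N E ` \<Omega>"
      using f by (auto simp: bij_betw_def)
    finally have eq: "(\<lambda>i. conj_by N U (opprod {..<N} n (\<lambda>j. psem {..<N} (c j) (sp j)) (row_supp n R i))) ` {..<n}
        = graph_gen N E ` \<Omega>" .
    have E_sym: "E v u \<and> u \<noteq> v" if "E u v" for u v using E that by (auto simp: simple_graph_def)
    \<comment> \<open>Independence and commutation have produced the graph; the rank condition now
      supplies its connectedness on \<Omega>.\<close>
    have "sympl (\<Sum>k\<in>row_supp n R i. sp k \<mu>) (\<Sum>k\<in>row_supp n R j. sp k \<mu>)
        = (if E (f i) (f j) \<and> (\<mu> = f i \<or> \<mu> = f j) then 1 else 0)"
      if "i < n" "j < n" "\<mu> < N" for i j \<mu>
      by (rule sympl_graph_rows[OF E_sym ql form[OF that(1,3)] form[OF that(2,3)]])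
    from rank_pseudo_incidence_graph_form[OF R f sub ne E this] have "induced_connected E \<Omega>"
      using \<open>?rank\<close> by blast
    then show ?L using U R E eq unfolding row_supp_def by blast
  qed
qed

end
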